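(* The linear map $r_A : \mathbf{Baxter} \to \mathbb{K}\langle A \rangle$ defined, for any pair of twin binary trees $J$, by $$r_A(\mathbf{P}_J) := \sum_{\substack{u \in A^* \\ (\mathrm{incr}(u),\, \mathrm{decr}(u)) \simeq J}} u,$$ provides a polynomial realization of $\mathbf{Baxter}$.
   Context: $\mathbb{K}$ is a field of characteristic zero. $A = \{a_1 < a_2 < \cdots\}$ is a totally ordered infinite alphabet; $\mathbb{K}\langle A\rangle$ denotes the algebra of (possibly infinite) $\mathbb{K}$-linear combinations of words on $A$ of bounded degree, with concatenation product. $\mathfrak{S}$ is the set of all permutations (of all sizes $n \ge 0$), seen as words; $\mathrm{std}(u)$ is the unique permutation of size $|u|$ with the same inversions as $u$. $\mathbf{FQSym}$ is the Hopf algebra over $\mathbb{K}$ with basis $\{\mathbf{F}_\sigma\}_{\sigma\in\mathfrak{S}}$, product $\mathbf{F}_\sigma\cdot\mathbf{F}_\nu = \sum_{\pi} \mathbf{F}_\pi$, where $\pi$ runs over all shuffles of $\sigma$ with the word obtained by adding $|\sigma|$ to every letter of $\nu$, and coproduct $\Delta(\mathbf{F}_\sigma) = \sum_{\sigma = uv} \mathbf{F}_{\mathrm{std}(u)} \otimes \mathbf{F}_{\mathrm{std}(v)}$. A binary tree is either a leaf (empty tree) or a node with a left and a right binary subtree. The canopy of a binary tree with $n$ nodes is the word of length $n-1$ obtained by reading its leaves from left to right except the first and the last, writing $0$ if the leaf is a right child and $1$ if it is a left child. A pair of twin binary trees is a pair of binary trees with the same number $n$ of nodes whose canopies differ at every position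 $1\le i\le n-1$. For a permutation $\sigma$, $\mathsf{P}(\sigma) = (T_L,T_R)$ where $T_L$ (resp. $T_R$) is the shape of the binary search tree obtained by inserting the letters of $\sigma$ from left to right (resp. right to left) with the standard binary search tree leaf insertion. $\mathbf{Baxter}$ is the Hopf subalgebra of $\mathbf{FQSym}$ with basis $\{\mathbf{P}_J\}$ indexed by pairs of twin binary trees, where $\mathbf{P}_J = \sum_{\sigma\in\mathfrak{S},\ \mathsf{P}(\sigma) = J} \mathbf{F}_\sigma$. For a word $u$, $\mathrm{incr}(u)$ is empty if $u$ is empty, and otherwise is the tree with root labeled $a$, left subtree $\mathrm{incr}(v)$ and right subtree $\mathrm{incr}(w)$, where $u = vaw$, $a = \min(u)$, $a < \min(v)$ (leftmost minimal letter). $\mathrm{decr}(u)$ is empty if $u$ is empty, and otherwise has root labeled $b$, left subtree $\mathrm{decr}(v)$, right subtree $\mathrm{decr}(w)$, where $u = vbw$, $b = \max(u)$, $b > \max(w)$ (rightmost maximal letter). $J_0 \simeq J_1$ means that the pairs of trees $J_0$ and $J_1$ have the same shape (labels forgotten). A polynomial realization is an injective algebra morphism $r_A$ into $\mathbb{K}\langle A\rangle$ which is compatible with the coalgebra structure in the sense that the coproduct is computed by the alphabet doubling trick: defining $r_X$ by the same formula for any totally ordered alphabet $X$, and letting $A \oplus B$ be the ordered sum of $A$ and a disjoint copy $B$ of $A$ (all letters of $A$ smaller than those of $B$), the image of $r_{A\oplus B}(x)$ after letting the letters of $A$ commute with those of $B$ (each word $u$ being sent to $u_{|A}\otimes u_{|B}$,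 its restrictions to $A$ and $B$) equals $(r_A \otimes r_B)(\Delta(x))$ for every $x$. *)

theory Defs
  imports Complex_Main "HOL-Library.Tree" "HOL-Library.Poly_Mapping"
begin

section \<open>Trees attached to words\<close>

text \<open>Shapes of trees, i.e. unlabelled binary trees, are elements of \<open>unit tree\<close>.\<close>

definition shape :: "'a tree \<Rightarrow> unit tree" where
  "shape t = map_tree (\<lambda>_. ()) t"

fun leaf_word :: "nat \<Rightarrow> 'a tree \<Rightarrow> nat list" where
  "leaf_word d Leaf = [d]"
| "leaf_word d (Node l a r) = leaf_word 1 l @ leaf_word 0 r"

text \<open>The parameter \<open>d\<close> of \<^const>\<open>leaf_word\<close> only matters for the empty tree, whose unique leaf
  is both the first and the last one and hence is removed.\<close>

definition canopy :: "'a tree \<Rightarrow> nat list" where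
  "canopy t = butlast (tl (leaf_word 0 t))"

definition twin_pairs :: "(unit tree \<times> unit tree) set" where
  "twin_pairs = {(t\<^sub>L, t\<^sub>R). size t\<^sub>L = size t\<^sub>R \<and>
     (\<forall>i < size t\<^sub>L - 1. canopy t\<^sub>L ! i \<noteq> canopy t\<^sub>R ! i)}"

text \<open>Binary search tree insertion is only applied to words without repeated letters, so the
  convention for equal letters plays no role.\<close>

fun bst_insert :: "'a::linorder \<Rightarrow> 'a tree \<Rightarrow> 'a tree" where
  "bst_insert x Leaf = Node Leaf x Leaf"
| "bst_insert x (Node l a r) =
     (if x \<le> a then Node (bst_insert x l) a r else Node l a (bst_insert x r))"

definition P_symbol :: "nat list \<Rightarrow> unit tree \<times> unit tree" where
  "P_symbol \<sigma> = (shape (fold bst_insert \<sigma> Leaf), shape (fold bst_insert (rev \<sigma>) Leaf))"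

text \<open>A nonempty word is cut at its leftmost minimal letter for \<open>incr\<close>, and at its rightmost
  maximal letter for \<open>decr\<close>.\<close>

lemma length_takeWhile_neq: "a \<in> set u \<Longrightarrow> length (takeWhile (\<lambda>x. x \<noteq> a) u) < length u"
  by (induction u) auto

lemma length_tl_dropWhile: "u \<noteq> [] \<Longrightarrow> length (tl (dropWhile P u)) < length u"
proof -
  assume "u \<noteq> []"
  then have "0 < length u" by simp
  then show ?thesis
    using length_dropWhile_le[of P u] unfolding length_tl by linarith
qed

function incr :: "'a::linorder list \<Rightarrow> 'a tree" where
  "incr u = (if u = [] then Leaf else
     (let a = Min (set u) in
       Node (incr (takeWhile (\<lambda>x. x \<noteq> a) u)) a (incr (tl (dropWhile (\<lambda>x. x \<noteq> a) u)))))"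
  by pat_completeness auto
termination
proof (relation "measure length", goal_cases)
  case (2 u a)
  then have "a \<in> set u" by simp
  then show ?case
    by (simp add: length_takeWhile_neq)
next
  case (3 u a)
  then show ?case
    by (simp add: length_tl_dropWhile del: length_tl)
qed simp

function decr :: "'a::linorder list \<Rightarrow> 'a tree" where
  "decr u = (if u = [] then Leaf else
     (let b = Max (set u) in
       Node (decr (rev (tl (dropWhile (\<lambda>x. x \<noteq> b) (rev u))))) b
            (decr (rev (takeWhile (\<lambda>x. x \<noteq> b) (rev u))))))"
  by pat_completeness auto
termination
proof (relation "measure length", goal_cases)
  case (3 u b)
  then have "b \<in> set (rev u)" by simp
  then have "length (takeWhile (\<lambda>x. x \<noteq> b) (rev u)) < length (rev u)"
    by (rule length_takeWhile_neq)
  then show ?case by simp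
next
  case (2 u b)
  then have "length (tl (dropWhile (\<lambda>x. x \<noteq> b) (rev u))) < length (rev u)"
    by (intro length_tl_dropWhile) simp
  then show ?case
    by (simp del: length_tl)
qed simp

declare incr.simps [simp del] decr.simps [simp del]

lemma incr_Nil: "incr [] = Leaf"
  by (simp add: incr.simps)

lemma incr_split:
  assumes "\<forall>x\<in>set v. a < x" "\<forall>x\<in>set w. a \<le> x"
  shows "incr (v @ a # w) = Node (incr v) a (incr w)"
proof -
  have "Min (set (v @ a # w)) = a"
    using assms by (intro Min_eqI) auto
  moreover have "takeWhile (\<lambda>x. x \<noteq> a) (v @ a # w) = v" "dropWhile (\<lambda>x. x \<noteq> a) (v @ a # w) = a # w"
    using assms by (auto simp: takeWhile_append dropWhile_append)
  ultimately show ?thesis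
    by (subst incr.simps) (simp add: Let_def)
qed

lemma decr_Nil: "decr [] = Leaf"
  by (simp add: decr.simps)

lemma decr_split:
  assumes "\<forall>x\<in>set v. x \<le> b" "\<forall>x\<in>set w. x < b"
  shows "decr (v @ b # w) = Node (decr v) b (decr w)"
proof -
  have "Max (set (v @ b # w)) = b"
    using assms by (intro Max_eqI) auto
  moreover have "takeWhile (\<lambda>x. x \<noteq> b) (rev (v @ b # w)) = rev w"
      "dropWhile (\<lambda>x. x \<noteq> b) (rev (v @ b # w)) = b # rev v"
    using assms by (auto simp: takeWhile_append dropWhile_append)
  ultimately show ?thesis
    by (subst decr.simps) (simp add: Let_def)
qed


section \<open>The Hopf algebra FQSym\<close>

text \<open>The space with basis indexed by \<open>'b\<close> is \<open>'b \<Rightarrow>\<^sub>0 'k\<close>, and the tensor product of the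
  spaces with bases indexed by \<open>'b\<close> and \<open>'c\<close> is the space with basis indexed by \<open>'b \<times> 'c\<close>.\<close>

definition pm_scale :: "'k::field \<Rightarrow> ('b \<Rightarrow>\<^sub>0 'k) \<Rightarrow> ('b \<Rightarrow>\<^sub>0 'k)" where
  "pm_scale c x = Poly_Mapping.map ((*) c) x"

lemma lookup_pm_scale [simp]:
  "Poly_Mapping.lookup (pm_scale c x) b = c * Poly_Mapping.lookup x b"
  by (simp add: pm_scale_def Poly_Mapping.map.rep_eq when_def)

global_interpretation pm: vector_space "pm_scale :: 'k::field \<Rightarrow> ('b \<Rightarrow>\<^sub>0 'k) \<Rightarrow> ('b \<Rightarrow>\<^sub>0 'k)"
  by unfold_locales (auto intro!: poly_mapping_eqI simp: lookup_add algebra_simps)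

definition tensor :: "('b \<Rightarrow>\<^sub>0 'k::field) \<Rightarrow> ('c \<Rightarrow>\<^sub>0 'k) \<Rightarrow> ('b \<times> 'c \<Rightarrow>\<^sub>0 'k)" where
  "tensor x y = (\<Sum>b\<in>Poly_Mapping.keys x. \<Sum>c\<in>Poly_Mapping.keys y.
     Poly_Mapping.single (b, c) (Poly_Mapping.lookup x b * Poly_Mapping.lookup y c))"

definition perms :: "nat list set" where
  "perms = {\<sigma>. distinct \<sigma> \<and> set \<sigma> = {1..length \<sigma>}}"

definition std :: "'a::linorder list \<Rightarrow> nat list" where
  "std u = (THE \<sigma>. \<sigma> \<in> perms \<and> length \<sigma> = length u \<and>
     (\<forall>i j. i < j \<and> j < length u \<longrightarrow> (\<sigma> ! i > \<sigma> ! j \<longleftrightarrow> u ! i > u ! j)))"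

definition F_basis :: "nat list \<Rightarrow> (nat list \<Rightarrow>\<^sub>0 'k::field)" where
  "F_basis \<sigma> = Poly_Mapping.single \<sigma> 1"

definition FQSym :: "(nat list \<Rightarrow>\<^sub>0 'k::field) set" where
  "FQSym = pm.span (F_basis ` perms)"

text \<open>The letters of \<open>\<sigma>\<close> and of the shifted word are disjoint, so each word occurs at most once as
  a shuffle, and the set \<^const>\<open>shuffles\<close> loses no multiplicity.\<close>

definition fqsym_mult ::
    "(nat list \<Rightarrow>\<^sub>0 'k::field) \<Rightarrow> (nat list \<Rightarrow>\<^sub>0 'k) \<Rightarrow> (nat list \<Rightarrow>\<^sub>0 'k)" where
  "fqsym_mult x y = (\<Sum>\<sigma>\<in>Poly_Mapping.keys x. \<Sum>\<nu>\<in>Poly_Mapping.keys y.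
     pm_scale (Poly_Mapping.lookup x \<sigma> * Poly_Mapping.lookup y \<nu>)
       (\<Sum>\<pi>\<in>shuffles \<sigma> (map (\<lambda>k. k + length \<sigma>) \<nu>). F_basis \<pi>))"

definition fqsym_one :: "nat list \<Rightarrow>\<^sub>0 'k::field" where
  "fqsym_one = F_basis []"

definition fqsym_coproduct ::
    "(nat list \<Rightarrow>\<^sub>0 'k::field) \<Rightarrow> (nat list \<times> nat list \<Rightarrow>\<^sub>0 'k)" where
  "fqsym_coproduct x = (\<Sum>\<sigma>\<in>Poly_Mapping.keys x. pm_scale (Poly_Mapping.lookup x \<sigma>)
     (\<Sum>i\<le>length \<sigma>. tensor (F_basis (std (take i \<sigma>))) (F_basis (std (drop i \<sigma>)))))"


section \<open>The Hopf subalgebra Baxter\<close>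

definition P_basis :: "unit tree \<times> unit tree \<Rightarrow> (nat list \<Rightarrow>\<^sub>0 'k::field)" where
  "P_basis J = (\<Sum>\<sigma>\<in>{\<sigma>\<in>perms. P_symbol \<sigma> = J}. F_basis \<sigma>)"

definition Baxter :: "(nat list \<Rightarrow>\<^sub>0 'k::field) set" where
  "Baxter = pm.span (P_basis ` twin_pairs)"

lemma size_bst_insert: "size (bst_insert x t) = Suc (size t)"
  by (induction t) auto

lemma size_fold_bst_insert: "size (fold bst_insert xs t) = length xs + size t"
  by (induction xs arbitrary: t) (auto simp: size_bst_insert)

lemma finite_P_class: "finite {\<sigma>\<in>perms. P_symbol \<sigma> = J}"
proof -
  have "length \<sigma> = size (fst J)" if "P_symbol \<sigma> = J" for \<sigma>
    using that by (auto simp: P_symbol_def shape_def size_fold_bst_insert)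
  then have "{\<sigma>\<in>perms. P_symbol \<sigma> = J} \<subseteq>
      {\<sigma>. set \<sigma> \<subseteq> {1..size (fst J)} \<and> length \<sigma> = size (fst J)}"
    by (auto simp: perms_def)
  then show ?thesis
    by (rule finite_subset) (simp add: finite_lists_length_eq)
qed

lemma Baxter_subset_FQSym: "Baxter \<subseteq> FQSym"
  unfolding Baxter_def FQSym_def
proof (rule pm.span_minimal)
  show "P_basis ` twin_pairs \<subseteq> pm.span (F_basis ` perms)"
    by (auto simp: P_basis_def intro!: pm.span_sum intro: pm.span_base)
qed (rule pm.subspace_span)


section \<open>Noncommutative series of bounded degree\<close>

definition bounded_series :: "('a list \<Rightarrow> 'k::field) set" where
  "bounded_series = {f. \<exists>d. \<forall>u. length u > d \<longrightarrow> f u = 0}"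

definition series_mult ::
    "('a list \<Rightarrow> 'k::field) \<Rightarrow> ('a list \<Rightarrow> 'k) \<Rightarrow> 'a list \<Rightarrow> 'k" where
  "series_mult f g = (\<lambda>w. \<Sum>i\<le>length w. f (take i w) * g (drop i w))"

definition series_one :: "'a list \<Rightarrow> 'k::field" where
  "series_one = (\<lambda>w. if w = [] then 1 else 0)"

text \<open>The sum type carries the ordered sum: all letters of the left summand are smaller than all
  letters of the right summand.\<close>

instantiation sum :: (linorder, linorder) linorder
begin

definition less_eq_sum :: "'a + 'b \<Rightarrow> 'a + 'b \<Rightarrow> bool" where
  "x \<le> y \<longleftrightarrow> (case (x, y) of
     (Inl a, Inl b) \<Rightarrow> a \<le> b | (Inl a, Inr b) \<Rightarrow> True
   | (Inr a, Inl b) \<Rightarrow> False | (Inr a, Inr b) \<Rightarrow> a \<le> b)"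

definition less_sum :: "'a + 'b \<Rightarrow> 'a + 'b \<Rightarrow> bool" where
  "x < y \<longleftrightarrow> x \<le> y \<and> \<not> y \<le> (x :: 'a + 'b)"

instance
  by standard (auto simp: less_eq_sum_def less_sum_def split: sum.splits)

end

definition restrict_left :: "('a + 'b) list \<Rightarrow> 'a list" where
  "restrict_left u = map projl (filter isl u)"

definition restrict_right :: "('a + 'b) list \<Rightarrow> 'b list" where
  "restrict_right u = map projr (filter (\<lambda>x. \<not> isl x) u)"

text \<open>Letting the letters of the two alphabets commute. The result is a series in pairs of words,
  the pair \<open>(v, w)\<close> standing for the tensor product of \<open>v\<close> and \<open>w\<close>; it is well defined since
  finitely many words have given restrictions.\<close>

definition split_alphabets :: "(('a + 'b) list \<Rightarrow> 'k::field) \<Rightarrow> 'a list \<times> 'b list \<Rightarrow> 'k" where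
  "split_alphabets f = (\<lambda>(v, w). \<Sum>u\<in>{u. restrict_left u = v \<and> restrict_right u = w}. f u)"


section \<open>Polynomial realizations\<close>

text \<open>For linear maps \<open>r\<close> and \<open>s\<close> on a subspace \<open>H\<close>, \<open>tensor_map H r s\<close> is their tensor product,
  defined on the tensor square of \<open>H\<close>: it sends a sum of tensors \<open>x \<otimes> y\<close> to the sum of the
  \<open>r x \<otimes> s y\<close>, whichever way the argument is written as such a sum.\<close>

definition tensor_square :: "('b \<Rightarrow>\<^sub>0 'k::field) set \<Rightarrow> ('b \<times> 'b \<Rightarrow>\<^sub>0 'k) set" where
  "tensor_square H = pm.span {tensor x y | x y. x \<in> H \<and> y \<in> H}"

definition tensor_map ::
    "('b \<Rightarrow>\<^sub>0 'k::field) set \<Rightarrow> (('b \<Rightarrow>\<^sub>0 'k) \<Rightarrow> 'a list \<Rightarrow> 'k) \<Rightarrow> (('b \<Rightarrow>\<^sub>0 'k) \<Rightarrow> 'c list \<Rightarrow> 'k) \<Rightarrow>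
     ('b \<times> 'b \<Rightarrow>\<^sub>0 'k) \<Rightarrow> 'a list \<times> 'c list \<Rightarrow> 'k" where
  "tensor_map H r s z = (THE t. \<exists>ps. set ps \<subseteq> H \<times> H \<and>
     z = (\<Sum>(x, y)\<leftarrow>ps. tensor x y) \<and>
     t = (\<lambda>(v, w). \<Sum>(x, y)\<leftarrow>ps. r x v * s y w))"

definition algebra_morphism_on ::
    "('b \<Rightarrow>\<^sub>0 'k::field) set \<Rightarrow> (('b \<Rightarrow>\<^sub>0 'k) \<Rightarrow> ('b \<Rightarrow>\<^sub>0 'k) \<Rightarrow> ('b \<Rightarrow>\<^sub>0 'k)) \<Rightarrow> ('b \<Rightarrow>\<^sub>0 'k) \<Rightarrow>
     (('b \<Rightarrow>\<^sub>0 'k) \<Rightarrow> 'a list \<Rightarrow> 'k) \<Rightarrow> bool" where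
  "algebra_morphism_on H mult one r \<longleftrightarrow>
     pm.subspace H \<and> one \<in> H \<and> (\<forall>x\<in>H. \<forall>y\<in>H. mult x y \<in> H) \<and>
     (\<forall>x\<in>H. r x \<in> bounded_series) \<and>
     (\<forall>x\<in>H. \<forall>y\<in>H. r (x + y) = (\<lambda>u. r x u + r y u)) \<and>
     (\<forall>c. \<forall>x\<in>H. r (pm_scale c x) = (\<lambda>u. c * r x u)) \<and>
     r one = series_one \<and>
     (\<forall>x\<in>H. \<forall>y\<in>H. r (mult x y) = series_mult (r x) (r y))"

text \<open>The map \<open>r\<close> is the realization over an alphabet \<open>A\<close>, and \<open>r2\<close> is the one given by the same
  formula over the ordered sum of two copies of \<open>A\<close>.\<close>

definition polynomial_realization ::
    "('b \<Rightarrow>\<^sub>0 'k::field) set \<Rightarrow> (('b \<Rightarrow>\<^sub>0 'k) \<Rightarrow> ('b \<Rightarrow>\<^sub>0 'k) \<Rightarrow> ('b \<Rightarrow>\<^sub>0 'k)) \<Rightarrow> ('b \<Rightarrow>\<^sub>0 'k) \<Rightarrow>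
     (('b \<Rightarrow>\<^sub>0 'k) \<Rightarrow> ('b \<times> 'b \<Rightarrow>\<^sub>0 'k)) \<Rightarrow>
     (('b \<Rightarrow>\<^sub>0 'k) \<Rightarrow> 'a list \<Rightarrow> 'k) \<Rightarrow> (('b \<Rightarrow>\<^sub>0 'k) \<Rightarrow> ('a + 'a) list \<Rightarrow> 'k) \<Rightarrow> bool" where
  "polynomial_realization H mult one coprod r r2 \<longleftrightarrow>
     algebra_morphism_on H mult one r \<and> inj_on r H \<and>
     (\<forall>x\<in>H. coprod x \<in> tensor_square H \<and>
        split_alphabets (r2 x) = tensor_map H r r (coprod x))"

text \<open>\<open>baxter_realization\<close> is the linear extension to \<open>Baxter\<close> of the map sending the basis element
  indexed by \<open>J\<close> to \<open>word_sum J\<close>. It is polymorphic in the alphabet.\<close>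

definition word_sum :: "unit tree \<times> unit tree \<Rightarrow> 'a::linorder list \<Rightarrow> 'k::field" where
  "word_sum J = (\<lambda>u. if (shape (incr u), shape (decr u)) = J then 1 else 0)"

definition baxter_coeff :: "(nat list \<Rightarrow>\<^sub>0 'k::field) \<Rightarrow> unit tree \<times> unit tree \<Rightarrow> 'k" where
  "baxter_coeff x J = pm.representation (P_basis ` twin_pairs) x (P_basis J)"

definition baxter_realization :: "(nat list \<Rightarrow>\<^sub>0 'k::field) \<Rightarrow> 'a::linorder list \<Rightarrow> 'k" where
  "baxter_realization x = (\<lambda>u. \<Sum>J\<in>{J\<in>twin_pairs. baxter_coeff x J \<noteq> 0}.
     baxter_coeff x J * word_sum J u)"

end

theory Submission
  imports Defs "HOL-Library.Multiset"
begin

text \<open>Write \<open>s(u)\<close> for the inverse of \<open>std u\<close>. Cutting \<open>u\<close> at its leftmost minimum, respectively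
  rightmost maximum, corresponds to cutting \<open>s(u)\<close> at its first, respectively last, letter, so the
  shapes of \<open>incr u\<close> and \<open>decr u\<close> are the components of \<open>P(s(u))\<close>. As every pair of twin binary trees
  is \<open>P(\<sigma>)\<close> for some \<open>\<sigma>\<close>, the elements of \<open>Baxter\<close> are exactly the elements of \<open>FQSym\<close> whose
  coefficients are constant on the fibres of \<open>P\<close>, and the realization reads the coefficient of \<open>s(u)\<close>
  as the coefficient of the word \<open>u\<close>.

  Restricting \<open>s(u)\<close> to its values at most \<open>i\<close>, respectively greater than \<open>i\<close>, gives \<open>s\<close> of the prefix,
  respectively suffix, of \<open>u\<close> cut at \<open>i\<close>; this matches the shuffle product with concatenation. Over an
  ordered sum of alphabets, \<open>s(u)\<close> lists first the positions of the small letters and then those of the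
  large ones; this matches deconcatenation with the alphabet doubling trick. \<open>Baxter\<close> is stable because
  the tree of a word determines the trees of its restrictions to intervals of values, and the trees of
  two words determine the tree of their concatenation.\<close>


section \<open>Binary search trees of words\<close>

definition bst_of :: "'a::linorder list \<Rightarrow> 'a tree" where
  "bst_of xs = fold bst_insert xs Leaf"

lemma bst_of_Nil [simp]: "bst_of [] = Leaf"
  by (simp add: bst_of_def)

lemma set_bst_insert [simp]: "set_tree (bst_insert x t) = insert x (set_tree t)"
  by (induction t) auto

lemma set_fold_bst_insert: "set_tree (fold bst_insert xs t) = set xs \<union> set_tree t"
  by (induction xs arbitrary: t) auto

lemma set_bst_of [simp]: "set_tree (bst_of xs) = set xs"
  by (simp add: bst_of_def set_fold_bst_insert)

lemma size_bst_of [simp]: "size (bst_of xs) = length xs"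
  by (simp add: bst_of_def size_fold_bst_insert)

lemma bst_bst_insert: "bst t \<Longrightarrow> x \<notin> set_tree t \<Longrightarrow> bst (bst_insert x t)"
  by (induction t) auto

lemma bst_fold_bst_insert:
  "bst t \<Longrightarrow> distinct xs \<Longrightarrow> set xs \<inter> set_tree t = {} \<Longrightarrow> bst (fold bst_insert xs t)"
  by (induction xs arbitrary: t) (auto simp: bst_bst_insert)

lemma bst_bst_of: "distinct xs \<Longrightarrow> bst (bst_of xs)"
  by (simp add: bst_of_def bst_fold_bst_insert)

lemma inorder_bst: "bst t \<Longrightarrow> inorder t = sorted_list_of_set (set_tree t)"
  using sorted_list_of_set.idem_if_sorted_distinct[of "inorder t"]
  by (simp add: bst_iff_sorted_wrt_less strict_sorted_iff)

lemma inorder_bst_of: "distinct xs \<Longrightarrow> inorder (bst_of xs) = sorted_list_of_set (set xs)"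
  by (simp add: inorder_bst bst_bst_of)

text \<open>Insertion never moves a node that is already present, so the root separates the inserted
  letters into two independent streams.\<close>

lemma fold_bst_insert_Node:
  "fold bst_insert ys (Node l x r) =
     Node (fold bst_insert (filter (\<lambda>y. y \<le> x) ys) l) x (fold bst_insert (filter (\<lambda>y. x < y) ys) r)"
  by (induction ys arbitrary: l r) auto

lemma bst_of_Cons:
  "bst_of (x # xs) = Node (bst_of (filter (\<lambda>y. y \<le> x) xs)) x (bst_of (filter (\<lambda>y. x < y) xs))"
  by (simp add: bst_of_def fold_bst_insert_Node)

lemma bst_of_snoc: "bst_of (xs @ [x]) = bst_insert x (bst_of xs)"
  by (simp add: bst_of_def)

section \<open>Restricting a search tree to small or large values\<close>

fun tree_up_to :: "'a::linorder \<Rightarrow> 'a tree \<Rightarrow> 'a tree" where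
  "tree_up_to x Leaf = Leaf"
| "tree_up_to x (Node l a r) = (if a \<le> x then Node l a (tree_up_to x r) else tree_up_to x l)"

fun tree_above :: "'a::linorder \<Rightarrow> 'a tree \<Rightarrow> 'a tree" where
  "tree_above x Leaf = Leaf"
| "tree_above x (Node l a r) = (if a \<le> x then tree_above x r else Node (tree_above x l) a r)"

text \<open>Cutting at \<open>x\<close> and inserting \<open>y\<close> walk along search paths with
  the same comparisons, so they commute on every tree; no search tree invariant has to be carried
  through the fold.\<close>

lemma tree_up_to_bst_insert:
  "tree_up_to x (bst_insert y t) = (if y \<le> x then bst_insert y (tree_up_to x t) else tree_up_to x t)"
  by (induction t) auto

lemma tree_above_bst_insert:
  "tree_above x (bst_insert y t) = (if y \<le> x then tree_above x t else bst_insert y (tree_above x t))"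
  by (induction t) auto

text \<open>Cutting commutes with each single insertion. Hence the tree of a restricted word is a
  function of the tree of the whole word, which is what stability under the product rests
  on.\<close>

lemma bst_of_filter_le: "bst_of (filter (\<lambda>y. y \<le> x) xs) = tree_up_to x (bst_of xs)"
proof -
  have "fold bst_insert (filter (\<lambda>y. y \<le> x) xs) (tree_up_to x t) = tree_up_to x (fold bst_insert xs t)" for t
  proof (induction xs arbitrary: t)
    case (Cons y xs)
    show ?case
      using Cons[of "bst_insert y t"] by (simp add: tree_up_to_bst_insert split: if_splits)
  qed simp
  from this[of Leaf] show ?thesis
    by (simp add: bst_of_def)
qed

lemma bst_of_filter_gt: "bst_of (filter (\<lambda>y. x < y) xs) = tree_above x (bst_of xs)"
proof -
  have "fold bst_insert (filter (\<lambda>y. x < y) xs) (tree_above x t) = tree_above x (fold bst_insert xs t)" for t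
  proof (induction xs arbitrary: t)
    case (Cons y xs)
    have "x < y \<longleftrightarrow> \<not> y \<le> x"
      by auto
    then show ?case
      using Cons[of "bst_insert y t"] by (simp add: tree_above_bst_insert split: if_splits)
  qed simp
  from this[of Leaf] show ?thesis
    by (simp add: bst_of_def)
qed

text \<open>The effect of inserting \<open>ys\<close> into any tree depends on
  \<open>bst_of ys\<close> only: at each node the letters sent to either side form a restriction of
  \<open>ys\<close>, whose tree is cut out of \<open>bst_of ys\<close>, and at a leaf that tree
  itself appears.\<close>

lemma bst_of_append_cong:
  assumes "bst_of xs = bst_of xs'" "bst_of ys = bst_of ys'"
  shows "bst_of (xs @ ys) = bst_of (xs' @ ys')"
proof -
  have "fold bst_insert ys t = fold bst_insert ys' t" for t
    using assms(2)
  proof (induction t arbitrary: ys ys')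
    case Leaf
    then show ?case
      by (simp add: bst_of_def)
  next
    case (Node l x r)
    have "bst_of (filter (\<lambda>y. y \<le> x) ys) = bst_of (filter (\<lambda>y. y \<le> x) ys')"
      "bst_of (filter (\<lambda>y. x < y) ys) = bst_of (filter (\<lambda>y. x < y) ys')"
      using Node.prems by (simp_all only: bst_of_filter_le bst_of_filter_gt)
    then show ?case
      unfolding fold_bst_insert_Node
      using Node.IH(1)[of "filter (\<lambda>y. y \<le> x) ys" "filter (\<lambda>y. y \<le> x) ys'"]
        Node.IH(2)[of "filter (\<lambda>y. x < y) ys" "filter (\<lambda>y. x < y) ys'"] by simp
  qed
  then show ?thesis
    using assms(1) by (simp add: bst_of_def)
qed

section \<open>Increasing relabellings and shapes\<close>

lemma map_tree_bst_insert:
  "strict_mono_on A f \<Longrightarrow> insert x (set_tree t) \<subseteq> A \<Longrightarrow>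
     bst_insert (f x) (map_tree f t) = map_tree f (bst_insert x t)"
  by (induction t) (auto simp: strict_mono_on_less_eq)

text \<open>Insertion only compares letters. Monotonicity is asked on a set \<open>A\<close>
  containing the letters because \<open>nth_least\<close> will be increasing on the ranks
  only.\<close>

lemma bst_of_map:
  assumes "strict_mono_on A f" "set xs \<subseteq> A"
  shows "bst_of (map f xs) = map_tree f (bst_of xs)"
proof -
  have "fold bst_insert (map f xs) (map_tree f t) = map_tree f (fold bst_insert xs t)"
    if "set xs \<union> set_tree t \<subseteq> A" for t
    using that
  proof (induction xs arbitrary: t)
    case (Cons x xs)
    then show ?case
      using map_tree_bst_insert[OF assms(1), of x t] Cons.IH[of "bst_insert x t"] by simp
  qed simp
  from this[of Leaf] show ?thesis
    using assms(2) by (simp add: bst_of_def)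
qed

lemma shape_simps [simp]: "shape Leaf = Leaf" "shape (Node l a r) = Node (shape l) () (shape r)"
  by (simp_all add: shape_def)

lemma size_shape [simp]: "size (shape t) = size t"
  by (simp add: shape_def)

lemma shape_map_tree [simp]: "shape (map_tree f t) = shape t"
  by (simp add: shape_def tree.map_comp comp_def)

lemma tree_eq_iff_shape_inorder: "t = t' \<longleftrightarrow> shape t = shape t' \<and> inorder t = inorder t'"
proof (induction t arbitrary: t')
  case Leaf
  then show ?case
    by (cases t') auto
next
  case (Node l a r)
  show ?case
  proof (cases t')
    case (Node l' a' r')
    \<comment> \<open>Equal lengths allow the equation between the two inorder words to be split at
      the roots.\<close>
    have "length (inorder l) = length (inorder l')" if "shape l = shape l'"
      using arg_cong[OF that, of size] by (simp add: length_inorder)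
    then show ?thesis
      using Node.IH Node by auto
  qed simp
qed

lemma permsD: "\<sigma> \<in> perms \<Longrightarrow> distinct \<sigma>" "\<sigma> \<in> perms \<Longrightarrow> set \<sigma> = {1..length \<sigma>}"
  by (auto simp: perms_def)

lemma P_symbol_conv: "P_symbol \<sigma> = (shape (bst_of \<sigma>), shape (bst_of (rev \<sigma>)))"
  by (simp add: P_symbol_def bst_of_def)

lemma length_P_symbol_eq:
  assumes "P_symbol \<sigma> = P_symbol \<tau>"
  shows "length \<sigma> = length \<tau>"
proof -
  have "size (fst (P_symbol \<sigma>)) = size (fst (P_symbol \<tau>))"
    using assms by (rule arg_cong)
  then show ?thesis
    by (simp add: P_symbol_conv)
qed

text \<open>Permutations of equal length have the same letters, hence search trees with the same
  inorder word, and then the shape determines the labels. Labelled trees can thus replace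
  shapes.\<close>

lemma P_symbol_eq_iff:
  assumes "\<sigma> \<in> perms" "\<tau> \<in> perms"
  shows "P_symbol \<sigma> = P_symbol \<tau> \<longleftrightarrow> bst_of \<sigma> = bst_of \<tau> \<and> bst_of (rev \<sigma>) = bst_of (rev \<tau>)"
proof
  assume *: "P_symbol \<sigma> = P_symbol \<tau>"
  have set_eq: "set \<sigma> = set \<tau>"
    using assms by (simp only: permsD length_P_symbol_eq[OF *])
  have "inorder (bst_of \<sigma>) = inorder (bst_of \<tau>)" "inorder (bst_of (rev \<sigma>)) = inorder (bst_of (rev \<tau>))"
    by (simp_all only: inorder_bst_of distinct_rev set_rev assms[THEN permsD(1)] set_eq)
  then show "bst_of \<sigma> = bst_of \<tau> \<and> bst_of (rev \<sigma>) = bst_of (rev \<tau>)"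
    using * unfolding P_symbol_conv prod.inject by (blast intro: tree_eq_iff_shape_inorder[THEN iffD2])
qed (simp add: P_symbol_conv)


section \<open>Twin binary trees\<close>

lemma length_leaf_word [simp]: "length (leaf_word d t) = Suc (size t)"
  by (induction t arbitrary: d) auto

text \<open>In a nonempty tree the first leaf is a left child and the last one a right child, so the
  two letters dropped by \<open>canopy\<close> are a leading \<open>1\<close> and a trailing
  \<open>0\<close>.\<close>

lemma leaf_word_eq_canopy: "t \<noteq> Leaf \<Longrightarrow> leaf_word d t = 1 # canopy t @ [0]"
proof -
  \<comment> \<open>The middle word must be the same for all \<open>d\<close>, because
    \<open>canopy\<close> is computed with \<open>d = 0\<close>.\<close>
  have *: "\<exists>c. \<forall>d. leaf_word d t = 1 # c @ [0]" if "t \<noteq> Leaf"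
    using that
  proof (induction t)
    case (Node l a r)
    then show ?case
      by (cases "l = Leaf"; cases "r = Leaf") fastforce+
  qed simp
  assume "t \<noteq> Leaf"
  from *[OF this] obtain c where "\<forall>d. leaf_word d t = 1 # c @ [0]"
    by blast
  then show ?thesis
    by (simp add: canopy_def)
qed

lemma canopy_Leaf [simp]: "canopy Leaf = []"
  by (simp add: canopy_def)

text \<open>At the root the last leaf of \<open>l\<close>, a right child, and the first leaf of
  \<open>r\<close>, a left child, become inner leaves. An empty subtree only yields an outer leaf,
  which is dropped.\<close>

lemma canopy_Node:
  "canopy (Node l a r) = (if l = Leaf then [] else canopy l @ [0]) @ (if r = Leaf then [] else 1 # canopy r)"
  unfolding canopy_def[of "Node l a r"]
  by (cases "l = Leaf"; cases "r = Leaf") (simp_all add: leaf_word_eq_canopy butlast_append)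

lemma canopy_shape [simp]: "canopy (shape t) = canopy t"
proof -
  have "leaf_word d (shape t) = leaf_word d t" for d
    by (induction t arbitrary: d) auto
  then show ?thesis
    by (simp add: canopy_def)
qed

lemma length_canopy [simp]: "length (canopy t) = size t - 1"
  by (simp add: canopy_def)

lemma set_leaf_word: "d \<in> {0, 1} \<Longrightarrow> set (leaf_word d t) \<subseteq> {0, 1}"
  by (induction t arbitrary: d) simp_all

lemma set_canopy: "set (canopy t) \<subseteq> {0, 1}"
  using set_leaf_word[of 0 t] in_set_butlastD[of _ "tl (leaf_word 0 t)"]
    list.set_sel(2)[of "leaf_word 0 t"] unfolding canopy_def
  by (metis butlast.simps(1) insert_iff list.sel(2) subset_iff)

section \<open>Canopies of search trees read from words\<close>

fun adjacent_map :: "('a \<Rightarrow> 'a \<Rightarrow> 'b) \<Rightarrow> 'a list \<Rightarrow> 'b list" where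
  "adjacent_map f (x # y # zs) = f x y # adjacent_map f (y # zs)"
| "adjacent_map f _ = []"

lemma adjacent_map_nth:
  "Suc i < length xs \<Longrightarrow> adjacent_map f xs ! i = f (xs ! i) (xs ! Suc i)"
proof (induction f xs arbitrary: i rule: adjacent_map.induct)
  case (1 f x y zs)
  then show ?case
    by (cases i) auto
qed auto

lemma adjacent_map_append:
  "adjacent_map f (xs @ x # ys) =
     (if xs = [] then [] else adjacent_map f xs @ [f (last xs) x]) @
     (if ys = [] then [] else f x (hd ys) # adjacent_map f ys)"
proof (induction xs rule: induct_list012)
  case 1
  then show ?case
    by (cases ys) auto
next
  case (2 y)
  then show ?case
    by (cases ys) auto
qed simp_all

lemma adjacent_map_cong:
  "distinct xs \<Longrightarrow> (\<And>x y. x \<in> set xs \<Longrightarrow> y \<in> set xs \<Longrightarrow> x \<noteq> y \<Longrightarrow> f x y = g x y) \<Longrightarrow>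
     adjacent_map f xs = adjacent_map g xs"
  by (induction xs rule: induct_list012) auto

text \<open>Going through the word restricted to the two letters makes the relation survive every
  filter that keeps both. It is unspecified if neither letter occurs.\<close>

definition precedes :: "'a list \<Rightarrow> 'a \<Rightarrow> 'a \<Rightarrow> bool" where
  "precedes xs a b \<longleftrightarrow> hd (filter (\<lambda>z. z = a \<or> z = b) xs) = a"

lemma precedes_filter: "P a \<Longrightarrow> P b \<Longrightarrow> precedes (filter P xs) a b = precedes xs a b"
proof -
  assume "P a" "P b"
  then have "filter (\<lambda>z. z = a \<or> z = b) (filter P xs) = filter (\<lambda>z. z = a \<or> z = b) xs"
    unfolding filter_filter by (intro filter_cong) auto
  then show ?thesis
    by (simp add: precedes_def)
qed

lemma precedes_Cons: "precedes (x # xs) a b = (if x = a then True else if x = b then a = b else precedes xs a b)"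
  by (auto simp: precedes_def)

text \<open>The restriction to two different letters that each occur once has length two, and
  reversal exchanges its first and last letter.\<close>

lemma precedes_rev:
  assumes "distinct xs" "a \<in> set xs" "b \<in> set xs" "a \<noteq> b"
  shows "precedes (rev xs) a b \<longleftrightarrow> \<not> precedes xs a b"
proof -
  define ys where "ys = filter (\<lambda>z. z = a \<or> z = b) xs"
  have *: "distinct ys" "set ys = {a, b}"
    using assms by (auto simp: ys_def)
  then have "length ys = 2"
    using assms(4) distinct_card[of ys] by simp
  then obtain c e where "ys = [c, e]"
    by (metis One_nat_def Suc_1 length_0_conv length_Suc_conv)
  moreover have "filter (\<lambda>z. z = a \<or> z = b) (rev xs) = rev ys"
    by (simp add: ys_def rev_filter)
  ultimately show ?thesis
    using * assms(4) by (auto simp: precedes_def ys_def[symmetric])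
qed

text \<open>In a binary search tree, of two neighbouring letters the one inserted later is a descendant
  of the other, and it carries the leaf between them.\<close>

lemma canopy_bst_of:
  "distinct xs \<Longrightarrow>
     canopy (bst_of xs) = adjacent_map (\<lambda>a b. if precedes xs a b then 1 else 0) (inorder (bst_of xs))"
proof (induction xs rule: length_induct)
  case (1 xs)
  show ?case
  proof (cases xs)
    case (Cons x ys)
    let ?f = "\<lambda>xs a b. if precedes xs a b then (1 :: nat) else 0"
    define us where "us = filter (\<lambda>y. y \<le> x) ys"
    define vs where "vs = filter (\<lambda>y. x < y) ys"
    have dist: "distinct ys" "x \<notin> set ys" "distinct us" "distinct vs"
      using 1(2) by (auto simp: Cons us_def vs_def)
    have "length us < length xs" "length vs < length xs"
      by (simp_all add: Cons us_def vs_def le_imp_less_Suc)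
    then have IH: "canopy (bst_of us) = adjacent_map (?f us) (inorder (bst_of us))"
      "canopy (bst_of vs) = adjacent_map (?f vs) (inorder (bst_of vs))"
      using 1(1) dist by blast+
    have "precedes us a b = precedes xs a b" if "a \<in> set us" "b \<in> set us" for a b
      using that dist unfolding us_def Cons
      by (subst precedes_filter) (auto simp: precedes_Cons)
    then have l: "adjacent_map (?f us) (inorder (bst_of us)) = adjacent_map (?f xs) (inorder (bst_of us))"
      using dist by (intro adjacent_map_cong) (simp_all add: inorder_bst_of)
    have "precedes vs a b = precedes xs a b" if "a \<in> set vs" "b \<in> set vs" for a b
      using that dist unfolding vs_def Cons
      by (subst precedes_filter) (auto simp: precedes_Cons)
    then have r: "adjacent_map (?f vs) (inorder (bst_of vs)) = adjacent_map (?f xs) (inorder (bst_of vs))"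
      using dist by (intro adjacent_map_cong) (simp_all add: inorder_bst_of)
    \<comment> \<open>The root \<open>x\<close> is the first letter inserted, so it precedes both of
      its neighbours in inorder: the leaf on its left reads \<open>0\<close>, the one on its right
      \<open>1\<close>.\<close>
    have last: "\<not> precedes xs (last (inorder (bst_of us))) x" if "bst_of us \<noteq> Leaf"
    proof -
      have "last (inorder (bst_of us)) \<in> set us"
        using that last_in_set[of "inorder (bst_of us)"] by simp
      then have "last (inorder (bst_of us)) \<noteq> x"
        using dist by (auto simp: us_def)
      then show ?thesis
        by (auto simp: Cons precedes_Cons)
    qed
    have hd: "precedes xs x y" for y
      by (simp add: Cons precedes_Cons)
    have "bst_of xs = Node (bst_of us) x (bst_of vs)"
      by (simp add: Cons bst_of_Cons us_def vs_def)
    then show ?thesis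
      using last by (simp add: canopy_Node adjacent_map_append IH l r hd)
  qed simp
qed

text \<open>Both trees have the same inorder word, and reversing \<sigma> reverses which of two
  neighbouring letters is inserted first, so every canopy letter changes.\<close>

lemma P_symbol_in_twin_pairs:
  assumes "distinct \<sigma>"
  shows "P_symbol \<sigma> \<in> twin_pairs"
proof -
  define xs where "xs = sorted_list_of_set (set \<sigma>)"
  have xs: "distinct xs" "set xs = set \<sigma>" "length xs = length \<sigma>"
    using assms by (simp_all add: xs_def distinct_card)
  have inorder: "inorder (bst_of \<sigma>) = xs" "inorder (bst_of (rev \<sigma>)) = xs"
    using assms by (simp_all add: xs_def inorder_bst_of)
  have "canopy (bst_of \<sigma>) ! i \<noteq> canopy (bst_of (rev \<sigma>)) ! i" if "i < length \<sigma> - 1" for i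
  proof -
    have i: "Suc i < length xs"
      using that xs by simp
    then have "xs ! i \<in> set \<sigma>" "xs ! Suc i \<in> set \<sigma>" "xs ! i \<noteq> xs ! Suc i"
      using xs nth_mem[of i xs] nth_mem[of "Suc i" xs] by (auto simp: nth_eq_iff_index_eq)
    then show ?thesis
      using assms i by (simp add: canopy_bst_of inorder adjacent_map_nth precedes_rev)
  qed
  then show ?thesis
    by (simp add: twin_pairs_def P_symbol_conv)
qed

text \<open>A node is a leaf of the tree precisely when its two neighbouring leaves read \<open>1 0\<close>; such a
  node can be removed, and inserting its letter again restores the tree.\<close>

lemma delete_terminal_node:
  assumes "bst t" "leaf_word d t = p @ 1 # 0 # q"
  shows "\<exists>t' e x ys zs. leaf_word d t' = p @ e # q \<and> inorder t = ys @ x # zs \<and>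
    inorder t' = ys @ zs \<and> length ys = length p \<and> bst_insert x t' = t"
  using assms
proof (induction t arbitrary: d p q)
  case (Node l a r)
  from Node.prems(2) obtain us where us:
    "leaf_word 1 l = p @ us \<and> us @ leaf_word 0 r = 1 # 0 # q \<or>
     leaf_word 1 l @ us = p \<and> leaf_word 0 r = us @ 1 # 0 # q"
    by (auto simp: append_eq_append_conv2)
  \<comment> \<open>Needed twice: the pattern \<open>1 0\<close> may start inside the leaf word of
    \<open>r\<close> or exactly at its beginning.\<close>
  have right: ?case if eq: "p = leaf_word 1 l @ us" "leaf_word 0 r = us @ 1 # 0 # q" for us
  proof -
    from Node.IH(2)[OF _ eq(2)] Node.prems(1) obtain r' e x ys zs where
      r': "leaf_word 0 r' = us @ e # q" "inorder r = ys @ x # zs" "inorder r' = ys @ zs"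
        "length ys = length us" "bst_insert x r' = r"
      by auto
    have "x \<in> set_tree r"
      unfolding set_inorder[symmetric] r'(2) by simp
    then have "bst_insert x (Node l a r') = Node l a r"
      using Node.prems(1) r'(5) by auto
    moreover have "leaf_word d (Node l a r') = p @ e # q"
      "inorder (Node l a r) = (inorder l @ a # ys) @ x # zs"
      "inorder (Node l a r') = (inorder l @ a # ys) @ zs"
      "length (inorder l @ a # ys) = length p"
      using r' eq by simp_all
    ultimately show ?thesis
      by blast
  qed
  from us show ?case
  proof (elim disjE conjE)
    assume *: "leaf_word 1 l = p @ us" "us @ leaf_word 0 r = 1 # 0 # q"
    consider "us = []" | "us = [1]" | us' where "us = 1 # 0 # us'"
      using *(2) by (auto simp: append_eq_Cons_conv)
    then show ?case
    proof cases
      case 1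
      then show ?thesis
        using * by (intro right[of "[]"]) simp_all
    next
      case 2
      \<comment> \<open>The pattern straddles the root. A nonempty \<open>l\<close> would end its
        leaf word with \<open>0\<close>, a nonempty \<open>r\<close> would start with
        \<open>1\<close>, so the root is the whole tree; removing it leaves the single leaf
        \<open>d\<close>.\<close>
      have "l = Leaf" "r = Leaf"
        using * 2 leaf_word_eq_canopy[of l 1] leaf_word_eq_canopy[of r 0] by force+
      then have "p = []" "q = []" "leaf_word d Leaf = p @ d # q" "bst_insert a Leaf = Node l a r"
        using * 2 by simp_all
      then show ?thesis
        using \<open>l = Leaf\<close> \<open>r = Leaf\<close>
        by (intro exI[of _ Leaf] exI[of _ d] exI[of _ a] exI[of _ "[]"]) simp
    next
      case 3
      then have eq: "leaf_word 1 l = p @ 1 # 0 # us'" "q = us' @ leaf_word 0 r"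
        using * by simp_all
      from Node.IH(1)[OF _ eq(1)] Node.prems(1) obtain l' e x ys zs where
        l': "leaf_word 1 l' = p @ e # us'" "inorder l = ys @ x # zs" "inorder l' = ys @ zs"
          "length ys = length p" "bst_insert x l' = l"
        by auto
      have "x \<in> set_tree l"
        unfolding set_inorder[symmetric] l'(2) by simp
      then have "bst_insert x (Node l' a r) = Node l a r"
        using Node.prems(1) l'(5) by auto
      moreover have "leaf_word d (Node l' a r) = p @ e # q"
        "inorder (Node l a r) = ys @ x # (zs @ a # inorder r)"
        "inorder (Node l' a r) = ys @ (zs @ a # inorder r)"
        using l' eq by simp_all
      ultimately show ?thesis
        using l'(4) by blast
    qed
  next
    assume "leaf_word 1 l @ us = p" "leaf_word 0 r = us @ 1 # 0 # q"
    then show ?case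
      by (intro right) simp_all
  qed
qed simp

section \<open>Grafting a tree at an outer leaf\<close>

fun graft_left :: "'a tree \<Rightarrow> 'a tree \<Rightarrow> 'a tree" where
  "graft_left s Leaf = s"
| "graft_left s (Node l a r) = Node (graft_left s l) a r"

fun graft_right :: "'a tree \<Rightarrow> 'a tree \<Rightarrow> 'a tree" where
  "graft_right s Leaf = s"
| "graft_right s (Node l a r) = Node l a (graft_right s r)"

lemma inorder_graft:
  "inorder (graft_left s t) = inorder s @ inorder t"
  "inorder (graft_right s t) = inorder t @ inorder s"
  by (induction t) auto

lemma graft_eq_Leaf_iff:
  "graft_left s t = Leaf \<longleftrightarrow> s = Leaf \<and> t = Leaf"
  "graft_right s t = Leaf \<longleftrightarrow> s = Leaf \<and> t = Leaf"
  by (cases t; simp)+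

lemma graft_Leaf [simp]: "graft_left Leaf t = t" "graft_right Leaf t = t"
  by (induction t) auto

text \<open>The leaf of \<open>t\<close> that receives \<open>s\<close> disappears, and the junction
  letter comes from an outer leaf of \<open>s\<close>: its last leaf \<open>0\<close> for
  \<open>graft_left\<close>, its first leaf \<open>1\<close> for \<open>graft_right\<close>. Merging
  two trees therefore leaves this letter free to choose.\<close>

lemma canopy_graft:
  assumes "s \<noteq> Leaf" "t \<noteq> Leaf"
  shows "canopy (graft_left s t) = canopy s @ 0 # canopy t"
    and "canopy (graft_right s t) = canopy t @ 1 # canopy s"
  using assms(2) by (induction t) (auto simp: canopy_Node graft_eq_Leaf_iff assms(1))

lemma tree_up_to_id: "(\<And>y. y \<in> set_tree t \<Longrightarrow> y \<le> x) \<Longrightarrow> tree_up_to x t = t"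
  by (induction t) auto

lemma tree_up_to_Leaf: "(\<And>y. y \<in> set_tree t \<Longrightarrow> x < y) \<Longrightarrow> tree_up_to x t = Leaf"
  by (induction t) (auto simp: not_le)

lemma tree_above_id: "(\<And>y. y \<in> set_tree t \<Longrightarrow> x < y) \<Longrightarrow> tree_above x t = t"
  by (induction t) (auto simp: not_le)

lemma tree_above_Leaf: "(\<And>y. y \<in> set_tree t \<Longrightarrow> y \<le> x) \<Longrightarrow> tree_above x t = Leaf"
  by (induction t) auto

text \<open>This recovers the two subtrees of a root \<open>x\<close> from their merged tree when
  \<open>x\<close> is put in front of a word for the latter.\<close>

lemma cut_graft:
  assumes "\<And>y. y \<in> set_tree l \<Longrightarrow> y \<le> x" "\<And>y. y \<in> set_tree r \<Longrightarrow> x < y"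
  shows "tree_up_to x (graft_left l r) = l" "tree_above x (graft_left l r) = r"
    and "tree_up_to x (graft_right r l) = l" "tree_above x (graft_right r l) = r"
proof -
  have l: "tree_up_to x l = l" "tree_above x l = Leaf"
    using assms(1) by (auto intro: tree_up_to_id tree_above_Leaf)
  have r: "tree_up_to x r = Leaf" "tree_above x r = r"
    using assms(2) by (auto intro: tree_up_to_Leaf tree_above_id)
  show "tree_up_to x (graft_left l r) = l" "tree_above x (graft_left l r) = r"
    using assms(2) by (induction r) (simp_all add: l flip: not_less)
  show "tree_up_to x (graft_right r l) = l" "tree_above x (graft_right r l) = r"
    using assms(1) by (induction l) (simp_all add: r)
qed

text \<open>By the canopy condition the root \<open>x\<close> of the left tree is a terminal node of the right tree.
  Remove \<open>x\<close> from both trees, merging the two subtrees of the root of the left one on the side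
  which keeps the canopies opposite; then \<open>x\<close> followed by a word for the smaller pair works.\<close>

lemma twin_bst_exists:
  assumes "bst t\<^sub>L" "inorder t\<^sub>R = inorder t\<^sub>L" "canopy t\<^sub>R = map (\<lambda>c. 1 - c) (canopy t\<^sub>L)"
  shows "\<exists>xs. bst_of xs = t\<^sub>L \<and> bst_of (rev xs) = t\<^sub>R"
  using assms
proof (induction "size t\<^sub>L" arbitrary: t\<^sub>L t\<^sub>R rule: less_induct)
  case less
  show ?case
  proof (cases t\<^sub>L)
    case Leaf
    then have "t\<^sub>R = Leaf"
      using less.prems(2) by simp
    then show ?thesis
      using Leaf by (intro exI[of _ "[]"]) simp
  next
    case (Node l x r)
    let ?co = "map (\<lambda>c. 1 - c :: nat)"
    \<comment> \<open>Complementing the canopy of \<open>t\<^sub>L\<close> turns the two letters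
      around its root into \<open>1 0\<close>; \<open>p\<close> and \<open>q\<close> are the rest of
      the leaf word of \<open>t\<^sub>R\<close>. If a subtree is empty, an outer leaf of
      \<open>t\<^sub>R\<close> supplies its letter of the pattern.\<close>
    define p where "p = (if l = Leaf then [] else 1 # ?co (canopy l))"
    define q where "q = (if r = Leaf then [] else ?co (canopy r) @ [0])"
    have lr: "\<And>y. y \<in> set_tree l \<Longrightarrow> y \<le> x" "\<And>y. y \<in> set_tree r \<Longrightarrow> x < y"
      using less.prems(1) Node by auto
    have "bst t\<^sub>R"
      using less.prems(1) unfolding bst_iff_sorted_wrt_less less.prems(2) .
    moreover have "t\<^sub>R \<noteq> Leaf"
      using less.prems(2) Node by auto
    ultimately have "t\<^sub>R \<noteq> Leaf" "bst t\<^sub>R"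
      by simp_all
    then have "leaf_word 0 t\<^sub>R = p @ 1 # 0 # q"
      using less.prems(3) Node
      by (simp add: leaf_word_eq_canopy canopy_Node p_def q_def)
    from delete_terminal_node[OF \<open>bst t\<^sub>R\<close> this] obtain t e y ys zs where t:
      "leaf_word 0 t = p @ e # q" "inorder t\<^sub>R = ys @ y # zs" "inorder t = ys @ zs"
      "length ys = length p" "bst_insert y t = t\<^sub>R"
      by blast
    \<comment> \<open>The removed node has the inorder rank of the root of \<open>t\<^sub>L\<close>,
      so its label is \<open>x\<close>.\<close>
    have "length p = size l"
      by (cases l) (simp_all add: p_def)
    then have y: "y = x" "ys = inorder l" "zs = inorder r"
      using t(2,4) less.prems(2) Node by auto
    have e: "e = 0 \<or> e = 1"
      using set_leaf_word[of 0 t] t(1) by auto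
    \<comment> \<open>When both subtrees are nonempty, \<open>e\<close> is the canopy letter of
      \<open>t\<close> at the junction, and the graft is chosen to put \<open>1 - e\<close> there.
      If one is empty, both grafts agree.\<close>
    define s where "s = (if e = 1 then graft_left l r else graft_right r l)"
    have inorder_s: "inorder s = inorder l @ inorder r"
      by (simp add: s_def inorder_graft)
    have "\<exists>xs. bst_of xs = s \<and> bst_of (rev xs) = t"
    proof (rule less.hyps)
      have "length (inorder s) = length (inorder l @ inorder r)"
        by (simp only: inorder_s)
      then show "size s < size t\<^sub>L"
        using Node by simp
      show "bst s"
        using less.prems(1) Node
        by (auto simp: bst_iff_sorted_wrt_less inorder_s sorted_wrt_append intro: less_trans)
      show "inorder t = inorder s"
        using t(3) y by (simp add: inorder_s)
      show "canopy t = ?co (canopy s)"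
        using e by (cases "l = Leaf"; cases "r = Leaf")
          (auto simp: canopy_def[of t] t(1) p_def q_def s_def canopy_graft butlast_append)
    qed
    then obtain xs where xs: "bst_of xs = s" "bst_of (rev xs) = t"
      by blast
    have "bst_of (x # xs) = t\<^sub>L"
      using lr unfolding bst_of_Cons bst_of_filter_le bst_of_filter_gt xs(1) Node s_def
      by (auto simp: cut_graft)
    moreover have "bst_of (rev (x # xs)) = t\<^sub>R"
      using t(5) y xs(2) by (simp add: bst_of_snoc)
    ultimately show ?thesis
      by blast
  qed
qed

lemma ex_labelling: "length xs = size t \<Longrightarrow> \<exists>t'. shape t' = t \<and> inorder t' = xs"
proof (induction t arbitrary: xs)
  case (Node l a r)
  let ?n = "size l"
  obtain l' where l': "shape l' = l" "inorder l' = take ?n xs"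
    using Node.IH(1)[of "take ?n xs"] Node.prems by auto
  obtain r' where r': "shape r' = r" "inorder r' = drop (Suc ?n) xs"
    using Node.IH(2)[of "drop (Suc ?n) xs"] Node.prems by auto
  have "shape (Node l' (xs ! ?n) r') = Node l a r" "inorder (Node l' (xs ! ?n) r') = xs"
    using l' r' Node.prems id_take_nth_drop[of ?n xs] by simp_all
  then show ?case
    by blast
qed auto

text \<open>Labelling both shapes in inorder by \<open>1\<close>, ..., \<open>n\<close> makes them
  search trees with complementary canopies, hence the two trees of a common word; its letters are
  \<open>1\<close>, ..., \<open>n\<close>, so it is a permutation.\<close>

lemma twin_pairs_eq: "twin_pairs = P_symbol ` perms"
proof (intro equalityI subsetI)
  fix J
  assume J: "J \<in> twin_pairs"
  define n where "n = size (fst J)"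
  have n: "size (snd J) = n"
    using J by (auto simp: twin_pairs_def n_def)
  obtain t\<^sub>L where tL: "shape t\<^sub>L = fst J" "inorder t\<^sub>L = [1..<Suc n]"
    using ex_labelling[of "[1..<Suc n]" "fst J"] by (auto simp: n_def simp del: upt_Suc)
  obtain t\<^sub>R where tR: "shape t\<^sub>R = snd J" "inorder t\<^sub>R = [1..<Suc n]"
    using ex_labelling[of "[1..<Suc n]" "snd J"] n by (auto simp del: upt_Suc)
  have canopies: "canopy t\<^sub>L = canopy (fst J)" "canopy t\<^sub>R = canopy (snd J)"
    by (simp_all flip: tL(1) tR(1))
  have "canopy t\<^sub>R = map (\<lambda>c. 1 - c) (canopy t\<^sub>L)"
  proof (rule nth_equalityI)
    show "length (canopy t\<^sub>R) = length (map (\<lambda>c. 1 - c) (canopy t\<^sub>L))"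
      by (simp add: canopies n flip: n_def)
    fix i
    assume i: "i < length (canopy t\<^sub>R)"
    then have i': "i < n - 1"
      by (simp add: canopies n)
    then have "canopy t\<^sub>L ! i \<in> set (canopy t\<^sub>L)" "canopy t\<^sub>R ! i \<in> set (canopy t\<^sub>R)"
      by (intro nth_mem; simp add: canopies n flip: n_def)+
    then have "canopy t\<^sub>L ! i \<in> {0, 1}" "canopy t\<^sub>R ! i \<in> {0, 1}"
      using set_canopy by blast+
    moreover have "canopy t\<^sub>L ! i \<noteq> canopy t\<^sub>R ! i"
      using J i' by (auto simp: twin_pairs_def canopies n_def)
    ultimately show "canopy t\<^sub>R ! i = map (\<lambda>c. 1 - c) (canopy t\<^sub>L) ! i"
      using i' by (auto simp: canopies simp flip: n_def)
  qed
  moreover have "bst t\<^sub>L"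
    by (simp add: bst_iff_sorted_wrt_less tL(2) del: upt_Suc)
  ultimately obtain \<sigma> where \<sigma>: "bst_of \<sigma> = t\<^sub>L" "bst_of (rev \<sigma>) = t\<^sub>R"
    using twin_bst_exists[of t\<^sub>L t\<^sub>R] tL(2) tR(2) by auto
  have "set \<sigma> = set (inorder t\<^sub>L)" "length \<sigma> = length (inorder t\<^sub>L)"
    by (simp_all flip: \<sigma>(1))
  then have "set \<sigma> = {1..n}" "length \<sigma> = n"
    unfolding tL(2) by auto
  then have "\<sigma> \<in> perms"
    by (simp add: perms_def card_distinct)
  moreover have "P_symbol \<sigma> = J"
    by (simp add: P_symbol_conv \<sigma> tL tR)
  ultimately show "J \<in> P_symbol ` perms"
    by blast
qed (auto simp: P_symbol_in_twin_pairs permsD)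


section \<open>Inverse standardization\<close>

text \<open>The inverse of the permutation \<open>std u\<close>, obtained by stably sorting the positions of \<open>u\<close>.\<close>

definition inv_std :: "'a::linorder list \<Rightarrow> nat list" where
  "inv_std u = sort_key (\<lambda>i. u ! (i - 1)) [1..<Suc (length u)]"

lemma length_inv_std [simp]: "length (inv_std u) = length u"
  by (simp add: inv_std_def del: upt_Suc)

lemma inv_std_in_perms: "inv_std u \<in> perms"
  by (auto simp: perms_def inv_std_def simp del: upt_Suc)

section \<open>Stable sorting by a key\<close>

lemma sort_key_cong_le:
  "(\<And>x y. x \<in> set xs \<Longrightarrow> y \<in> set xs \<Longrightarrow> f x \<le> f y \<longleftrightarrow> g x \<le> g y) \<Longrightarrow> sort_key f xs = sort_key g xs"
proof (induction xs)
  case (Cons x xs)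
  have "insort_key f x ys = insort_key g x ys" if "set ys \<subseteq> set xs" for ys
    using that Cons.prems by (induction ys) auto
  moreover have "sort_key f xs = sort_key g xs"
    using Cons by simp
  ultimately show ?case
    by simp
qed simp

lemma sort_key_cong_on: "(\<And>x. x \<in> set xs \<Longrightarrow> f x = g x) \<Longrightarrow> sort_key f xs = sort_key g xs"
  by (rule sort_key_cong_le) simp

lemma sort_key_map: "sort_key f (map g xs) = map g (sort_key (f \<circ> g) xs)"
proof (induction xs)
  case (Cons x xs)
  have "insort_key f (g x) (map g ys) = map g (insort_key (f \<circ> g) x ys)" for ys
    by (induction ys) auto
  then show ?case
    using Cons by (simp add: comp_def)
qed simp

text \<open>By stability a minimal key comes first once all elements before it have strictly larger
  keys; ties after it do no harm. This is the tie rule of \<open>incr\<close>, and the mirror image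
  below is that of \<open>decr\<close>.\<close>

lemma sort_key_leftmost_min:
  assumes "\<And>x. x \<in> set xs \<Longrightarrow> f k < f x" "\<And>y. y \<in> set ys \<Longrightarrow> f k \<le> f y"
  shows "sort_key f (xs @ k # ys) = k # sort_key f (xs @ ys)"
  using assms(1)
proof (induction xs)
  case Nil
  show ?case
    using assms(2) by (simp add: insort_is_Cons)
next
  case (Cons x xs)
  then show ?case
    using less_le_not_le[of "f k" "f x"] by simp
qed

lemma sort_key_rightmost_max:
  assumes "\<And>x. x \<in> set xs \<Longrightarrow> f x \<le> f k" "\<And>y. y \<in> set ys \<Longrightarrow> f y < f k"
  shows "sort_key f (xs @ k # ys) = sort_key f (xs @ ys) @ [k]"
  using assms(1)
proof (induction xs)
  case Nil
  have "insort_key f k zs = zs @ [k]" if "\<And>y. y \<in> set zs \<Longrightarrow> f y < f k" for zs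
    using that
  proof (induction zs)
    case (Cons z zs)
    then show ?case
      using less_le_not_le[of "f z" "f k"] by simp
  qed simp
  from this[of "sort_key f ys"] show ?case
    using assms(2) by simp
next
  case (Cons x xs)
  have "insort_key f x (zs @ [k]) = insort_key f x zs @ [k]" for zs
    using Cons.prems[of x] by (induction zs) auto
  then show ?case
    using Cons by simp
qed

text \<open>Filtering commutes with stable sorting, and the positions up to \<open>i\<close> carry
  the letters of the prefix. For the suffix the positions are shifted by \<open>i\<close>.\<close>

lemma filter_le_inv_std:
  assumes "i \<le> length u"
  shows "filter (\<lambda>k. k \<le> i) (inv_std u) = inv_std (take i u)"
proof -
  have "filter (\<lambda>k. k \<le> i) [1..<Suc (length u)] = [1..<Suc i]"
  proof -
    have "[1..<Suc (length u)] = [1..<Suc i] @ [Suc i..<Suc (length u)]"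
      using assms upt_add_eq_append[of 1 "Suc i" "length u - i"] by simp
    moreover have "filter (\<lambda>k. k \<le> i) [1..<Suc i] = [1..<Suc i]"
      by (rule filter_True) (simp del: upt_Suc)
    moreover have "filter (\<lambda>k. k \<le> i) [Suc i..<Suc (length u)] = []"
      by (rule filter_False) (simp del: upt_Suc)
    ultimately show ?thesis
      by (simp only: filter_append append_Nil2)
  qed
  then show ?thesis
    using assms unfolding inv_std_def filter_sort
    by (auto intro!: sort_key_cong_on simp: min_def simp del: upt_Suc)
qed

lemma filter_gt_inv_std:
  assumes "i \<le> length u"
  shows "filter (\<lambda>k. i < k) (inv_std u) = map (\<lambda>k. k + i) (inv_std (drop i u))"
proof -
  have "filter (\<lambda>k. i < k) [1..<Suc (length u)] = map (\<lambda>k. k + i) [1..<Suc (length u - i)]"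
  proof -
    have "[1..<Suc (length u)] = [1..<Suc i] @ [Suc i..<Suc (length u)]"
      using assms upt_add_eq_append[of 1 "Suc i" "length u - i"] by simp
    moreover have "filter (\<lambda>k. i < k) [1..<Suc i] = []"
      by (rule filter_False) (simp del: upt_Suc)
    moreover have "filter (\<lambda>k. i < k) [Suc i..<Suc (length u)] = [Suc i..<Suc (length u)]"
      by (rule filter_True) (simp del: upt_Suc)
    moreover have "map (\<lambda>k. k + i) [1..<Suc (length u - i)] = [Suc i..<Suc (length u)]"
      using assms by (intro nth_equalityI) (simp_all del: upt_Suc)
    ultimately show ?thesis
      by (simp only: filter_append append_Nil)
  qed
  then show ?thesis
    using assms unfolding inv_std_def filter_sort
    by (auto simp: sort_key_map add.commute intro!: sort_key_cong_on arg_cong[of _ _ "map _"] simp del: upt_Suc)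
qed

section \<open>The trees of \<open>incr\<close> and \<open>decr\<close> as search trees\<close>

lemma upt_split: "[1..<Suc (length (v @ a # w))] =
    [1..<Suc (length v)] @ Suc (length v) # [Suc (Suc (length v))..<Suc (length (v @ a # w))]"
  using upt_add_eq_append[of 1 "Suc (length v)" "Suc (length w)"]
  by (simp add: upt_conv_Cons del: upt_Suc)

text \<open>Common step for both trees, with \<sigma> playing the part of
  \<open>f (inv_std u)\<close>: the position of the cut letter is inserted first, and the positions
  below and above it are those of \<open>v\<close> and, shifted, of \<open>w\<close>.\<close>

lemma shape_bst_of_inv_std_split:
  assumes "u = v @ a # w" "filter (\<lambda>k. k \<noteq> Suc (length v)) \<sigma> = xs"
    and "\<And>P. filter P \<sigma> = f (filter P (inv_std u))"
    and "f = id \<or> f = rev"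
  shows "shape (bst_of (Suc (length v) # xs)) =
    Node (shape (bst_of (f (inv_std v)))) () (shape (bst_of (f (inv_std w))))"
proof -
  have "filter (\<lambda>k. k \<le> Suc (length v)) xs = filter (\<lambda>k. k \<le> length v) \<sigma>"
    unfolding assms(2)[symmetric] filter_filter by (intro filter_cong) auto
  also have "\<dots> = f (inv_std v)"
    unfolding assms(3) using assms(1) by (subst filter_le_inv_std) auto
  finally have 1: "filter (\<lambda>k. k \<le> Suc (length v)) xs = f (inv_std v)" .
  have "filter (\<lambda>k. Suc (length v) < k) xs = filter (\<lambda>k. Suc (length v) < k) \<sigma>"
    unfolding assms(2)[symmetric] filter_filter by (intro filter_cong) auto
  also have "\<dots> = f (map (\<lambda>k. k + Suc (length v)) (inv_std w))"
    unfolding assms(3) using assms(1) by (subst filter_gt_inv_std) auto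
  also have "\<dots> = map (\<lambda>k. k + Suc (length v)) (f (inv_std w))"
    using assms(4) by (auto simp: rev_map)
  finally have 2: "filter (\<lambda>k. Suc (length v) < k) xs = map (\<lambda>k. k + Suc (length v)) (f (inv_std w))" .
  have "bst_of (map (\<lambda>k. k + Suc (length v)) (f (inv_std w))) =
      map_tree (\<lambda>k. k + Suc (length v)) (bst_of (f (inv_std w)))"
    by (rule bst_of_map[of UNIV]) (auto simp: strict_mono_on_def)
  then show ?thesis
    by (simp add: bst_of_Cons 1 2)
qed

lemma shape_bst_of_inv_std: "shape (bst_of (inv_std u)) = shape (incr u)"
proof (induction u rule: length_induct)
  case (1 u)
  show ?case
  proof (cases "u = []")
    case False
    define a where "a = Min (set u)"
    have "a \<in> set u"
      using False by (simp add: a_def)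
    then obtain v w where u: "u = v @ a # w" "a \<notin> set v"
      by (meson split_list_first)
    have min: "\<forall>x\<in>set v. a < x" "\<forall>x\<in>set w. a \<le> x"
      using u(2) Min_le[of "set u", folded a_def] by (auto simp: less_le u(1))
    \<comment> \<open>The position of the leftmost minimum is sorted to the front and becomes the
      root of the search tree.\<close>
    obtain xs where xs: "inv_std u = Suc (length v) # xs"
    proof
      show "inv_std u = Suc (length v) # sort_key (\<lambda>i. u ! (i - 1))
          ([1..<Suc (length v)] @ [Suc (Suc (length v))..<Suc (length u)])"
        unfolding inv_std_def u(1) upt_split
        using min by (intro sort_key_leftmost_min) (auto simp: nth_append nth_Cons' simp del: upt_Suc)
    qed
    have "Suc (length v) \<notin> set xs"
      using permsD(1)[OF inv_std_in_perms[of u]] by (simp add: xs)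
    then have "filter (\<lambda>k. k \<noteq> Suc (length v)) (inv_std u) = xs"
      by (auto simp: xs intro!: filter_True)
    from shape_bst_of_inv_std_split[OF u(1) this, of id]
    show ?thesis
      using 1 by (simp add: xs[symmetric] u(1) incr_split[OF min])
  qed (simp add: inv_std_def incr_Nil)
qed

lemma shape_bst_of_rev_inv_std: "shape (bst_of (rev (inv_std u))) = shape (decr u)"
proof (induction u rule: length_induct)
  case (1 u)
  show ?case
  proof (cases "u = []")
    case False
    define b where "b = Max (set u)"
    have "b \<in> set u"
      using False by (simp add: b_def)
    then obtain v w where u: "u = v @ b # w" "b \<notin> set w"
      by (meson split_list_last)
    have max: "\<forall>x\<in>set v. x \<le> b" "\<forall>x\<in>set w. x < b"
      using u(2) Max_ge[of "set u", folded b_def] by (auto simp: less_le u(1))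
    \<comment> \<open>The position of the rightmost maximum is sorted to the end, so it is the first
      letter of the reversed word.\<close>
    obtain xs where xs: "inv_std u = xs @ [Suc (length v)]"
    proof
      show "inv_std u = sort_key (\<lambda>i. u ! (i - 1))
          ([1..<Suc (length v)] @ [Suc (Suc (length v))..<Suc (length u)]) @ [Suc (length v)]"
        unfolding inv_std_def u(1) upt_split
        using max by (intro sort_key_rightmost_max) (auto simp: nth_append nth_Cons' simp del: upt_Suc)
    qed
    have "Suc (length v) \<notin> set xs"
      using permsD(1)[OF inv_std_in_perms[of u]] by (simp add: xs)
    then have "filter (\<lambda>k. k \<noteq> Suc (length v)) (rev (inv_std u)) = rev xs"
      by (auto simp: xs intro!: filter_True)
    from shape_bst_of_inv_std_split[OF u(1) this, of rev]
    have "shape (bst_of (Suc (length v) # rev xs)) =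
        Node (shape (bst_of (rev (inv_std v)))) () (shape (bst_of (rev (inv_std w))))"
      by (simp add: rev_filter)
    moreover have "decr u = Node (decr v) b (decr w)"
      by (simp add: u(1) decr_split[OF max])
    moreover have "length v < length u" "length w < length u"
      by (simp_all add: u(1))
    ultimately show ?thesis
      using 1 by (simp add: xs)
  qed (simp add: inv_std_def decr_Nil)
qed

text \<open>The condition on \<open>u\<close> in the realization thereby becomes membership of
  \<open>inv_std u\<close> in a fibre of \<open>P_symbol\<close>.\<close>

lemma P_symbol_inv_std: "P_symbol (inv_std u) = (shape (incr u), shape (decr u))"
  by (simp add: P_symbol_conv shape_bst_of_inv_std shape_bst_of_rev_inv_std)

text \<open>The infinite alphabet enters here: \<sigma> of any length needs that many different
  letters.\<close>

lemma ex_inv_std: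
  fixes a :: "nat \<Rightarrow> 'a::linorder"
  assumes "strict_mono a" "\<sigma> \<in> perms"
  obtains u :: "'a list" where "inv_std u = \<sigma>"
proof
  define n where "n = length \<sigma>"
  \<comment> \<open>\<open>pos\<close> inverts \<sigma>, with indices from 0. Writing
    \<open>a j\<close> at position \<open>\<sigma> ! j\<close> makes the keys increase along
    \<sigma>, so sorting the positions returns \<sigma>.\<close>
  define pos where "pos = inv_into {..<n} ((!) \<sigma>)"
  define u where "u = map (\<lambda>i. a (pos i)) [1..<Suc n]"
  have \<sigma>: "distinct \<sigma>" "set \<sigma> = {1..n}"
    using assms(2) by (simp_all add: permsD n_def)
  have pos: "pos (\<sigma> ! j) = j" if "j < n" for j
    unfolding pos_def using that \<sigma>(1) by (intro inv_into_f_f) (auto simp: inj_on_nth n_def)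
  have u_nth: "u ! (\<sigma> ! j - 1) = a j" if "j < n" for j
  proof -
    have "\<sigma> ! j \<in> {1..n}"
      using that \<sigma>(2) nth_mem[of j \<sigma>] by (simp add: n_def)
    then show ?thesis
      using that pos by (auto simp: u_def simp del: upt_Suc)
  qed
  have map: "map (\<lambda>i. u ! (i - 1)) \<sigma> = map a [0..<n]"
    using u_nth by (intro nth_equalityI) (simp_all add: n_def[symmetric])
  have "inv_std u = sort_key (\<lambda>i. u ! (i - 1)) [1..<Suc n]"
    by (simp add: inv_std_def u_def del: upt_Suc)
  also have "\<dots> = \<sigma>"
  proof (rule sort_key_inj_key_eq)
    show "mset [1..<Suc n] = mset \<sigma>"
      using set_eq_iff_mset_eq_distinct[of "[1..<Suc n]" \<sigma>] \<sigma>
      by (simp add: atLeastLessThanSuc_atLeastAtMost del: upt_Suc)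
    have "distinct (map (\<lambda>i. u ! (i - 1)) \<sigma>)"
      unfolding map using assms(1) by (simp add: distinct_map strict_mono_imp_inj_on)
    then have "inj_on (\<lambda>i. u ! (i - 1)) (set \<sigma>)"
      by (simp add: distinct_map)
    then show "inj_on (\<lambda>i. u ! (i - 1)) (set [1..<Suc n])"
      using \<sigma>(2) by (simp add: atLeastLessThanSuc_atLeastAtMost del: upt_Suc)
    show "sorted (map (\<lambda>i. u ! (i - 1)) \<sigma>)"
      unfolding map by (simp add: sorted_iff_nth_mono strict_mono_less_eq[OF assms(1)])
  qed
  finally show "inv_std u = \<sigma>" .
qed


section \<open>Baxter inside FQSym\<close>

lemma lookup_F_basis: "Poly_Mapping.lookup (F_basis \<sigma>) \<tau> = (if \<sigma> = \<tau> then 1 else 0)"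
  by (simp add: F_basis_def lookup_single when_def)

lemma lookup_P_basis:
  "Poly_Mapping.lookup (P_basis J) \<sigma> = (if \<sigma> \<in> perms \<and> P_symbol \<sigma> = J then 1 else 0)"
proof -
  have "Poly_Mapping.lookup (P_basis J) \<sigma> =
      (\<Sum>\<tau>\<in>{\<tau>\<in>perms. P_symbol \<tau> = J}. if \<tau> = \<sigma> then 1 else 0 :: 'a)"
    by (simp add: P_basis_def lookup_sum lookup_F_basis)
  then show ?thesis
    by (simp add: finite_P_class)
qed

lemma lookup_tensor:
  "Poly_Mapping.lookup (tensor x y) (b, c) = Poly_Mapping.lookup x b * Poly_Mapping.lookup y c"
proof -
  have "Poly_Mapping.lookup (tensor x y) (b, c) =
      (\<Sum>b'\<in>Poly_Mapping.keys x. \<Sum>c'\<in>Poly_Mapping.keys y. if c' = c then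
         (if b' = b then Poly_Mapping.lookup x b' * Poly_Mapping.lookup y c' else 0) else 0)"
    unfolding tensor_def lookup_sum by (intro sum.cong) (auto simp: lookup_single)
  also have "\<dots> = (\<Sum>b'\<in>Poly_Mapping.keys x. if b' = b then
      (if c \<in> Poly_Mapping.keys y then Poly_Mapping.lookup x b' * Poly_Mapping.lookup y c else 0) else 0)"
    by (auto intro!: sum.cong)
  also have "\<dots> = Poly_Mapping.lookup x b * Poly_Mapping.lookup y c"
    by (auto simp: in_keys_iff)
  finally show ?thesis .
qed

text \<open>Unspecified unless \<open>J\<close> is a pair of twin binary trees.\<close>

definition P_rep :: "unit tree \<times> unit tree \<Rightarrow> nat list" where
  "P_rep J = (SOME \<sigma>. \<sigma> \<in> perms \<and> P_symbol \<sigma> = J)"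

lemma P_rep:
  assumes "J \<in> twin_pairs"
  shows "P_rep J \<in> perms" "P_symbol (P_rep J) = J"
proof -
  have "\<exists>\<sigma>. \<sigma> \<in> perms \<and> P_symbol \<sigma> = J"
    using assms by (auto simp: twin_pairs_eq)
  from someI_ex[OF this] show "P_rep J \<in> perms" "P_symbol (P_rep J) = J"
    by (simp_all add: P_rep_def)
qed

lemma P_symbol_perms: "\<sigma> \<in> perms \<Longrightarrow> P_symbol \<sigma> \<in> twin_pairs"
  by (simp add: twin_pairs_eq)

text \<open>\<open>P_basis J\<close> is the indicator function of the fibre over \<open>J\<close>. A
  function constant on fibres is the combination whose coefficient at \<open>P_basis J\<close> is
  its value at \<open>P_rep J\<close>, over the finitely many fibres meeting its support.\<close>

lemma Baxter_iff:
  "x \<in> Baxter \<longleftrightarrow> Poly_Mapping.keys x \<subseteq> perms \<and>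
     (\<forall>\<sigma>\<in>perms. \<forall>\<tau>\<in>perms. P_symbol \<sigma> = P_symbol \<tau> \<longrightarrow> Poly_Mapping.lookup x \<sigma> = Poly_Mapping.lookup x \<tau>)"
  (is "_ \<longleftrightarrow> ?C x")
proof
  assume "x \<in> Baxter"
  then have *: "(\<sigma> \<notin> perms \<longrightarrow> Poly_Mapping.lookup x \<sigma> = 0) \<and>
     (P_symbol \<sigma> = P_symbol \<tau> \<longrightarrow> \<sigma> \<in> perms \<longrightarrow> \<tau> \<in> perms \<longrightarrow>
        Poly_Mapping.lookup x \<sigma> = Poly_Mapping.lookup x \<tau>)" for \<sigma> \<tau>
    unfolding Baxter_def
  proof (induction rule: pm.span_induct_alt)
    case (step c b y)
    then obtain J where "b = P_basis J"
      by blast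
    then show ?case
      using step.IH by (simp add: lookup_add lookup_P_basis)
  qed simp
  show "?C x"
    using * unfolding in_keys_iff subset_iff by blast
next
  assume x: "?C x"
  define Js where "Js = P_symbol ` Poly_Mapping.keys x"
  have Js: "finite Js" "Js \<subseteq> twin_pairs"
    using x by (auto simp: Js_def P_symbol_perms)
  have "x = (\<Sum>J\<in>Js. pm_scale (Poly_Mapping.lookup x (P_rep J)) (P_basis J))"
  proof (rule poly_mapping_eqI)
    fix \<sigma>
    show "Poly_Mapping.lookup x \<sigma> =
        Poly_Mapping.lookup (\<Sum>J\<in>Js. pm_scale (Poly_Mapping.lookup x (P_rep J)) (P_basis J)) \<sigma>"
    proof (cases "\<sigma> \<in> perms")
      case True
      have "Poly_Mapping.lookup (\<Sum>J\<in>Js. pm_scale (Poly_Mapping.lookup x (P_rep J)) (P_basis J)) \<sigma> =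
          (\<Sum>J\<in>Js. if J = P_symbol \<sigma> then Poly_Mapping.lookup x (P_rep J) else 0)"
        unfolding lookup_sum using True by (intro sum.cong) (auto simp: lookup_P_basis)
      also have "\<dots> = (if P_symbol \<sigma> \<in> Js then Poly_Mapping.lookup x (P_rep (P_symbol \<sigma>)) else 0)"
        using Js(1) by simp
      also have "Poly_Mapping.lookup x (P_rep (P_symbol \<sigma>)) = Poly_Mapping.lookup x \<sigma>"
        using x True P_rep[OF P_symbol_perms[OF True]] by blast
      also have "(if P_symbol \<sigma> \<in> Js then Poly_Mapping.lookup x \<sigma> else 0) = Poly_Mapping.lookup x \<sigma>"
        by (auto simp: Js_def in_keys_iff)
      finally show ?thesis ..
    next
      case False
      then have "Poly_Mapping.lookup x \<sigma> = 0"
        using x by (auto simp: in_keys_iff)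
      then show ?thesis
        using False by (simp add: lookup_sum lookup_P_basis)
    qed
  qed
  also have "\<dots> \<in> Baxter"
    unfolding Baxter_def using Js(2)
    by (intro pm.span_sum pm.span_scale pm.span_base) auto
  finally show "x \<in> Baxter" .
qed

lemma P_basis_in_Baxter: "J \<in> twin_pairs \<Longrightarrow> P_basis J \<in> Baxter"
  unfolding Baxter_def by (intro pm.span_base) simp

lemma inj_on_P_basis: "inj_on (P_basis :: _ \<Rightarrow> nat list \<Rightarrow>\<^sub>0 'k::field) twin_pairs"
proof
  fix J K
  assume *: "J \<in> twin_pairs" "K \<in> twin_pairs" "(P_basis J :: nat list \<Rightarrow>\<^sub>0 'k) = P_basis K"
  have "Poly_Mapping.lookup (P_basis J :: nat list \<Rightarrow>\<^sub>0 'k) (P_rep J) =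
      Poly_Mapping.lookup (P_basis K :: nat list \<Rightarrow>\<^sub>0 'k) (P_rep J)"
    by (simp add: *)
  then show "J = K"
    using P_rep[OF *(1)] by (simp add: lookup_P_basis split: if_splits)
qed

text \<open>Different fibres are disjoint, so evaluating at \<open>P_rep J\<close> isolates the
  coefficient of \<open>P_basis J\<close>.\<close>

lemma independent_P_basis: "pm.independent (P_basis ` twin_pairs :: (nat list \<Rightarrow>\<^sub>0 'k::field) set)"
  unfolding pm.independent_explicit_finite_subsets
proof (intro allI impI ballI)
  fix A and f :: "(nat list \<Rightarrow>\<^sub>0 'k) \<Rightarrow> 'k" and b
  assume A: "A \<subseteq> P_basis ` twin_pairs" "finite A" "(\<Sum>v\<in>A. pm_scale (f v) v) = 0" "b \<in> A"
  then obtain J where J: "J \<in> twin_pairs" "b = P_basis J"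
    by blast
  have "Poly_Mapping.lookup v (P_rep J) = (if v = b then 1 else 0)" if "v \<in> A" for v
    using that A(1) J P_rep[OF J(1)] inj_on_P_basis[THEN inj_onD] by (auto simp: lookup_P_basis)
  then have "Poly_Mapping.lookup (\<Sum>v\<in>A. pm_scale (f v) v) (P_rep J) = (\<Sum>v\<in>A. if v = b then f v else 0)"
    by (auto simp: lookup_sum intro!: sum.cong)
  then show "f b = 0"
    using A by simp
qed

text \<open>Only one fibre contains \<sigma>, so evaluating the basis expansion of \<open>x\<close>
  at \<sigma> leaves a single coefficient.\<close>

lemma baxter_coeff_eq:
  fixes x :: "nat list \<Rightarrow>\<^sub>0 'k::field"
  assumes "x \<in> Baxter" "\<sigma> \<in> perms"
  shows "baxter_coeff x (P_symbol \<sigma>) = Poly_Mapping.lookup x \<sigma>"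
proof -
  let ?B = "P_basis ` twin_pairs :: (nat list \<Rightarrow>\<^sub>0 'k) set"
  let ?r = "pm.representation ?B x"
  have "(\<Sum>b | ?r b \<noteq> 0. pm_scale (?r b) b) = x"
    using assms(1) by (intro pm.sum_nonzero_representation_eq independent_P_basis) (simp add: Baxter_def)
  then have "Poly_Mapping.lookup x \<sigma> = Poly_Mapping.lookup (\<Sum>b | ?r b \<noteq> 0. pm_scale (?r b) b) \<sigma>"
    by simp
  also have "\<dots> = (\<Sum>b | ?r b \<noteq> 0. if b = P_basis (P_symbol \<sigma>) then ?r b else 0)"
    unfolding lookup_sum
  proof (rule sum.cong)
    fix b
    assume "b \<in> {b. ?r b \<noteq> 0}"
    then obtain J where J: "J \<in> twin_pairs" "b = P_basis J"
      using pm.representation_ne_zero[of ?B x b] by blast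
    have "b = P_basis (P_symbol \<sigma>) \<longleftrightarrow> P_symbol \<sigma> = J"
      using J P_symbol_perms[OF assms(2)] inj_on_P_basis[THEN inj_onD, of J "P_symbol \<sigma>"] by auto
    then show "Poly_Mapping.lookup (pm_scale (?r b) b) \<sigma> =
        (if b = P_basis (P_symbol \<sigma>) then ?r b else 0)"
      using J assms(2) by (simp add: lookup_P_basis)
  qed simp
  also have "\<dots> = baxter_coeff x (P_symbol \<sigma>)"
    by (simp add: baxter_coeff_def pm.finite_representation)
  finally show ?thesis ..
qed

text \<open>The realization of \<open>Baxter\<close> is the restriction of the usual realization of \<open>FQSym\<close>.\<close>

lemma baxter_realization_eq:
  fixes x :: "nat list \<Rightarrow>\<^sub>0 'k::field"
  assumes "x \<in> Baxter"
  shows "baxter_realization x u = Poly_Mapping.lookup x (inv_std u)"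
proof -
  let ?Js = "{J\<in>twin_pairs. baxter_coeff x J \<noteq> 0}"
  \<comment> \<open>A sum over an infinite set would be \<open>0\<close> by default, so finiteness
    is transferred from the representation along the injective \<open>P_basis\<close>.\<close>
  have "finite (P_basis ` ?Js :: (nat list \<Rightarrow>\<^sub>0 'k) set)"
    using pm.finite_representation[of "P_basis ` twin_pairs" x]
    by (rule rev_finite_subset) (auto simp: baxter_coeff_def)
  moreover have "inj_on (P_basis :: _ \<Rightarrow> nat list \<Rightarrow>\<^sub>0 'k) ?Js"
    using inj_on_P_basis by (rule inj_on_subset) auto
  ultimately have "finite ?Js"
    by (rule finite_imageD)
  have "baxter_realization x u = (\<Sum>J\<in>?Js. if J = P_symbol (inv_std u) then baxter_coeff x J else 0)"
    unfolding baxter_realization_def word_sum_def P_symbol_inv_std by (intro sum.cong) auto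
  also have "\<dots> = baxter_coeff x (P_symbol (inv_std u))"
    using \<open>finite ?Js\<close> by (auto simp: P_symbol_perms inv_std_in_perms)
  also have "\<dots> = Poly_Mapping.lookup x (inv_std u)"
    using assms by (rule baxter_coeff_eq[OF _ inv_std_in_perms])
  finally show ?thesis .
qed

lemma baxter_realization_P_basis:
  assumes "J \<in> twin_pairs"
  shows "baxter_realization (P_basis J) = (\<lambda>u. if (shape (incr u), shape (decr u)) = J then 1 else 0)"
  by (rule ext) (simp add: baxter_realization_eq P_basis_in_Baxter assms lookup_P_basis
      inv_std_in_perms P_symbol_inv_std)

text \<open>The two-variable form of the argument for \<open>Baxter_iff\<close>: the coefficient of
  a tensor of basis elements is the value at the pair of representatives.\<close>

lemma tensor_square_BaxterI:
  assumes keys: "Poly_Mapping.keys z \<subseteq> perms \<times> perms"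
    and cls: "\<And>\<sigma> \<sigma>' \<nu> \<nu>'. \<sigma> \<in> perms \<Longrightarrow> \<sigma>' \<in> perms \<Longrightarrow> \<nu> \<in> perms \<Longrightarrow> \<nu>' \<in> perms \<Longrightarrow>
      P_symbol \<sigma> = P_symbol \<sigma>' \<Longrightarrow> P_symbol \<nu> = P_symbol \<nu>' \<Longrightarrow>
      Poly_Mapping.lookup z (\<sigma>, \<nu>) = Poly_Mapping.lookup z (\<sigma>', \<nu>')"
  shows "z \<in> tensor_square Baxter"
proof -
  define S where "S = (\<lambda>(\<sigma>, \<nu>). (P_symbol \<sigma>, P_symbol \<nu>)) ` Poly_Mapping.keys z"
  have S: "finite S" "S \<subseteq> twin_pairs \<times> twin_pairs"
    using keys by (auto simp: S_def P_symbol_perms)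
  define c where "c = (\<lambda>(J, K). Poly_Mapping.lookup z (P_rep J, P_rep K))"
  have "z = (\<Sum>p\<in>S. pm_scale (c p) (tensor (P_basis (fst p)) (P_basis (snd p))))"
  proof (rule poly_mapping_eqI)
    fix p :: "nat list \<times> nat list"
    obtain \<sigma> \<nu> where p: "p = (\<sigma>, \<nu>)"
      by fastforce
    show "Poly_Mapping.lookup z p =
        Poly_Mapping.lookup (\<Sum>p\<in>S. pm_scale (c p) (tensor (P_basis (fst p)) (P_basis (snd p)))) p"
    proof (cases "\<sigma> \<in> perms \<and> \<nu> \<in> perms")
      case True
      let ?q = "(P_symbol \<sigma>, P_symbol \<nu>)"
      have "Poly_Mapping.lookup (\<Sum>p\<in>S. pm_scale (c p) (tensor (P_basis (fst p)) (P_basis (snd p)))) p =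
          (\<Sum>q\<in>S. if q = ?q then c q else 0)"
        unfolding lookup_sum p using True by (intro sum.cong) (auto simp: lookup_tensor lookup_P_basis)
      also have "\<dots> = (if ?q \<in> S then c ?q else 0)"
        using S(1) by simp
      also have "c ?q = Poly_Mapping.lookup z p"
        using True P_rep[OF P_symbol_perms] by (auto simp: c_def p intro!: cls)
      also have "(if ?q \<in> S then Poly_Mapping.lookup z p else 0) = Poly_Mapping.lookup z p"
        by (force simp: S_def p in_keys_iff)
      finally show ?thesis ..
    next
      case False
      then have "Poly_Mapping.lookup z p = 0"
        using keys by (auto simp: p in_keys_iff)
      then show ?thesis
        using False by (auto simp: lookup_sum p lookup_tensor lookup_P_basis)
    qed
  qed
  also have "\<dots> \<in> tensor_square Baxter"
    unfolding tensor_square_def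
  proof (intro pm.span_sum pm.span_scale pm.span_base)
    fix p
    assume "p \<in> S"
    then have "fst p \<in> twin_pairs" "snd p \<in> twin_pairs"
      using S(2) by auto
    then show "tensor (P_basis (fst p)) (P_basis (snd p)) \<in> {tensor x y |x y. x \<in> Baxter \<and> y \<in> Baxter}"
      using P_basis_in_Baxter by blast
  qed
  finally show ?thesis .
qed

text \<open>If \<open>r\<close> and \<open>s\<close> read coefficients at \<open>p v\<close> and
  \<open>q w\<close>, any decomposition into tensors gives the coefficient of \<open>z\<close> at
  \<open>(p v, q w)\<close>. The value is thus independent of the decomposition, as the definite
  description requires.\<close>

lemma tensor_map_eq:
  fixes z :: "'b \<times> 'b \<Rightarrow>\<^sub>0 'k::field"
  assumes H: "pm.subspace H" and z: "z \<in> tensor_square H"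
    and r: "\<And>x v. x \<in> H \<Longrightarrow> r x v = Poly_Mapping.lookup x (p v)"
    and s: "\<And>x w. x \<in> H \<Longrightarrow> s x w = Poly_Mapping.lookup x (q w)"
  shows "tensor_map H r s z = (\<lambda>(v, w). Poly_Mapping.lookup z (p v, q w))"
proof -
  have val: "(\<lambda>(v, w). \<Sum>(x, y)\<leftarrow>ps. r x v * s y w) =
      (\<lambda>(v, w). Poly_Mapping.lookup (\<Sum>(x, y)\<leftarrow>ps. tensor x y) (p v, q w))"
    if "set ps \<subseteq> H \<times> H" for ps
    using that by (induction ps) (auto simp: fun_eq_iff lookup_add lookup_tensor r s)
  have "\<exists>ps. set ps \<subseteq> H \<times> H \<and> z = (\<Sum>(x, y)\<leftarrow>ps. tensor x y)"
    using z unfolding tensor_square_def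
  proof (induction rule: pm.span_induct_alt)
    case base
    show ?case
      by (intro exI[of _ "[]"]) simp
  next
    case (step c t z)
    then obtain ps x y where ps: "set ps \<subseteq> H \<times> H" "z = (\<Sum>(x, y)\<leftarrow>ps. tensor x y)"
      and t: "t = tensor x y" "x \<in> H" "y \<in> H"
      by blast
    \<comment> \<open>Lists of pairs carry no scalars, so the scalar is absorbed into the first
      factor.\<close>
    have "pm_scale c t = tensor (pm_scale c x) y"
      by (intro poly_mapping_eqI) (auto simp: t lookup_tensor)
    then show ?case
      using ps t pm.subspace_scale[OF H, of x c] by (intro exI[of _ "(pm_scale c x, y) # ps"]) simp
  qed
  then show ?thesis
    unfolding tensor_map_def by (intro the_equality) (auto simp: val)
qed


section \<open>Product\<close>

lemma ex_nat_word:
  assumes "\<sigma> \<in> perms"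
  shows "\<exists>u :: nat list. inv_std u = \<sigma>"
proof -
  have "strict_mono (\<lambda>n :: nat. n)"
    by (simp add: strict_mono_def)
  from ex_inv_std[OF this assms] show ?thesis
    by blast
qed

lemma shape_bst_of_map:
  "strict_mono_on A f \<Longrightarrow> set xs \<subseteq> A \<Longrightarrow> shape (bst_of (map f xs)) = shape (bst_of xs)"
  by (simp add: bst_of_map)

lemma strict_mono_on_add: "strict_mono_on A (\<lambda>k. k + i :: nat)"
  by (simp add: strict_mono_on_def)

text \<open>Prefixes and suffixes of \<open>u\<close> are restrictions of \<open>inv_std u\<close>
  to small and large values, and their trees are cut out of the trees of \<open>inv_std u\<close>;
  the shift in the suffix is invisible in the shape.\<close>

lemma P_symbol_take_drop:
  assumes "P_symbol (inv_std u) = P_symbol (inv_std v)" "i \<le> length u"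
  shows "P_symbol (inv_std (take i u)) = P_symbol (inv_std (take i v))"
    and "P_symbol (inv_std (drop i u)) = P_symbol (inv_std (drop i v))"
proof -
  have len: "length u = length v"
    using length_P_symbol_eq[OF assms(1)] by simp
  have bst: "bst_of (inv_std u) = bst_of (inv_std v)" "bst_of (rev (inv_std u)) = bst_of (rev (inv_std v))"
    using assms(1) P_symbol_eq_iff[OF inv_std_in_perms inv_std_in_perms, of u v] by simp_all
  have take: "bst_of (inv_std (take i w)) = tree_up_to i (bst_of (inv_std w))"
    "bst_of (rev (inv_std (take i w))) = tree_up_to i (bst_of (rev (inv_std w)))"
    if "i \<le> length w" for w :: "'c::linorder list"
    unfolding filter_le_inv_std[OF that, symmetric] rev_filter bst_of_filter_le by (rule refl)+
  show "P_symbol (inv_std (take i u)) = P_symbol (inv_std (take i v))"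
    using assms(2) len unfolding P_symbol_conv by (simp only: take bst)
  have drop: "shape (bst_of (inv_std (drop i w))) = shape (tree_above i (bst_of (inv_std w)))"
    "shape (bst_of (rev (inv_std (drop i w)))) = shape (tree_above i (bst_of (rev (inv_std w))))"
    if "i \<le> length w" for w :: "'c::linorder list"
    unfolding bst_of_filter_gt[symmetric] rev_filter[symmetric] filter_gt_inv_std[OF that] rev_map
    by (simp_all only: shape_bst_of_map[OF strict_mono_on_add subset_UNIV])
  show "P_symbol (inv_std (drop i u)) = P_symbol (inv_std (drop i v))"
    using assms(2) len unfolding P_symbol_conv by (simp only: drop bst)
qed

text \<open>The two shuffled words occupy the values up to and above \<open>length \<sigma>\<close>,
  so restricting a shuffle to these ranges recovers them, and the restrictions of
  \<open>inv_std w\<close> come from a prefix and a suffix of \<open>w\<close>.\<close>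

lemma inv_std_in_shuffles_iff:
  assumes "\<sigma> \<in> perms"
  shows "inv_std w \<in> shuffles \<sigma> (map (\<lambda>k. k + length \<sigma>) \<nu>) \<and> \<nu> \<in> perms \<longleftrightarrow>
    length \<sigma> \<le> length w \<and> inv_std (take (length \<sigma>) w) = \<sigma> \<and> inv_std (drop (length \<sigma>) w) = \<nu>"
proof (intro iffI conjI; elim conjE)
  assume shuffle: "inv_std w \<in> shuffles \<sigma> (map (\<lambda>k. k + length \<sigma>) \<nu>)" and "\<nu> \<in> perms"
  show le: "length \<sigma> \<le> length w"
    using length_shuffles[OF shuffle] by simp
  have disjoint: "set \<sigma> \<inter> set (map (\<lambda>k. k + length \<sigma>) \<nu>) = {}"
    using assms \<open>\<nu> \<in> perms\<close> by (auto simp: permsD(2))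
  have mem: "k \<in> set \<sigma> \<longleftrightarrow> k \<le> length \<sigma>" if "k \<in> set (inv_std w)" for k
    using that assms inv_std_in_perms[of w] by (auto simp: permsD(2))
  have "inv_std (take (length \<sigma>) w) = filter (\<lambda>k. k \<in> set \<sigma>) (inv_std w)"
    unfolding filter_le_inv_std[OF le, symmetric] using mem by (auto intro: filter_cong)
  then show "inv_std (take (length \<sigma>) w) = \<sigma>"
    using filter_shuffles_disjoint1(1)[OF disjoint shuffle] by simp
  have "map (\<lambda>k. k + length \<sigma>) (inv_std (drop (length \<sigma>) w)) = filter (\<lambda>k. k \<notin> set \<sigma>) (inv_std w)"
    unfolding filter_gt_inv_std[OF le, symmetric] using mem by (auto intro: filter_cong)
  then have "map (\<lambda>k. k + length \<sigma>) (inv_std (drop (length \<sigma>) w)) = map (\<lambda>k. k + length \<sigma>) \<nu>"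
    using filter_shuffles_disjoint1(2)[OF disjoint shuffle] by simp
  then show "inv_std (drop (length \<sigma>) w) = \<nu>"
    by (simp add: map_injective inj_on_def)
next
  assume *: "length \<sigma> \<le> length w" "inv_std (take (length \<sigma>) w) = \<sigma>" "inv_std (drop (length \<sigma>) w) = \<nu>"
  show "\<nu> \<in> perms"
    using *(3) inv_std_in_perms by blast
  show "inv_std w \<in> shuffles \<sigma> (map (\<lambda>k. k + length \<sigma>) \<nu>)"
    using partition_in_shuffles[of "inv_std w" "\<lambda>k. k \<le> length \<sigma>"]
    by (simp add: filter_le_inv_std *(1,2) not_le filter_gt_inv_std *(3))
qed

lemma lookup_sum_F_basis:
  "finite S \<Longrightarrow> Poly_Mapping.lookup (\<Sum>\<pi>\<in>S. F_basis \<pi>) \<tau> = (if \<tau> \<in> S then 1 else 0)"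
  by (simp add: lookup_sum lookup_F_basis)

lemma keys_fqsym_mult:
  assumes "Poly_Mapping.keys x \<subseteq> perms" "Poly_Mapping.keys y \<subseteq> perms"
  shows "Poly_Mapping.keys (fqsym_mult x y) \<subseteq> perms"
proof
  fix \<pi>
  assume "\<pi> \<in> Poly_Mapping.keys (fqsym_mult x y)"
  then have "Poly_Mapping.lookup (fqsym_mult x y) \<pi> \<noteq> 0"
    by (simp add: in_keys_iff)
  then obtain \<sigma> where \<sigma>: "\<sigma> \<in> Poly_Mapping.keys x"
    "(\<Sum>\<nu>\<in>Poly_Mapping.keys y. Poly_Mapping.lookup x \<sigma> * Poly_Mapping.lookup y \<nu> *
       (if \<pi> \<in> shuffles \<sigma> (map (\<lambda>k. k + length \<sigma>) \<nu>) then 1 else 0)) \<noteq> 0"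
    unfolding fqsym_mult_def lookup_sum[of _ "Poly_Mapping.keys _"] lookup_pm_scale
      lookup_sum_F_basis[OF finite_shuffles]
    by (rule sum.not_neutral_contains_not_neutral)
  from \<sigma>(2) obtain \<nu> where "\<nu> \<in> Poly_Mapping.keys y"
    "Poly_Mapping.lookup x \<sigma> * Poly_Mapping.lookup y \<nu> *
       (if \<pi> \<in> shuffles \<sigma> (map (\<lambda>k. k + length \<sigma>) \<nu>) then 1 else 0) \<noteq> 0"
    by (rule sum.not_neutral_contains_not_neutral)
  with \<sigma>(1) have *: "\<sigma> \<in> Poly_Mapping.keys x" "\<nu> \<in> Poly_Mapping.keys y"
    "\<pi> \<in> shuffles \<sigma> (map (\<lambda>k. k + length \<sigma>) \<nu>)"
    by (simp_all split: if_splits)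
  have perms: "\<sigma> \<in> perms" "\<nu> \<in> perms"
    using * assms by auto
  have "distinct \<pi>"
    using perms by (intro distinct_disjoint_shuffles[OF _ _ _ *(3)])
      (auto simp: permsD distinct_map inj_on_def)
  moreover have "set \<pi> = {1..length \<pi>}"
  proof -
    have "set \<pi> = {1..length \<sigma>} \<union> (\<lambda>k. k + length \<sigma>) ` {1..length \<nu>}"
      using perms set_shuffles[OF *(3)] by (simp add: permsD(2))
    also have "\<dots> = {1..length \<sigma> + length \<nu>}"
      unfolding image_add_atLeastAtMost' by (intro set_eqI) auto
    finally show ?thesis
      using length_shuffles[OF *(3)] by simp
  qed
  ultimately show "\<pi> \<in> perms"
    by (simp add: perms_def)
qed

text \<open>Read through \<open>inv_std\<close>, this is the convolution that defines
  \<open>series_mult\<close>.\<close>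

lemma lookup_fqsym_mult:
  assumes "Poly_Mapping.keys x \<subseteq> perms" "Poly_Mapping.keys y \<subseteq> perms"
  shows "Poly_Mapping.lookup (fqsym_mult x y) (inv_std w) =
    (\<Sum>i\<le>length w. Poly_Mapping.lookup x (inv_std (take i w)) * Poly_Mapping.lookup y (inv_std (drop i w)))"
proof -
  let ?x = "Poly_Mapping.lookup x" and ?y = "Poly_Mapping.lookup y"
  let ?s = "\<lambda>i. inv_std (take i w)" and ?t = "\<lambda>i. inv_std (drop i w)"
  have "Poly_Mapping.lookup (fqsym_mult x y) (inv_std w) =
      (\<Sum>\<sigma>\<in>Poly_Mapping.keys x. \<Sum>\<nu>\<in>Poly_Mapping.keys y. ?x \<sigma> * ?y \<nu> *
         (if inv_std w \<in> shuffles \<sigma> (map (\<lambda>k. k + length \<sigma>) \<nu>) then 1 else 0))"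
    by (simp add: fqsym_mult_def lookup_sum lookup_F_basis)
  also have "\<dots> = (\<Sum>\<sigma>\<in>Poly_Mapping.keys x. \<Sum>\<nu>\<in>Poly_Mapping.keys y. \<Sum>i\<le>length w.
      if \<nu> = ?t i then (if \<sigma> = ?s i then ?x \<sigma> * ?y \<nu> else 0) else 0)"
  proof (intro sum.cong refl)
    fix \<sigma> \<nu>
    assume "\<sigma> \<in> Poly_Mapping.keys x" "\<nu> \<in> Poly_Mapping.keys y"
    then have perms: "\<sigma> \<in> perms" "\<nu> \<in> perms"
      using assms by auto
    \<comment> \<open>By comparing lengths, only the cut at \<open>i = length \<sigma>\<close> can
      yield \<sigma>.\<close>
    have "(\<Sum>i\<le>length w. if \<nu> = ?t i then (if \<sigma> = ?s i then ?x \<sigma> * ?y \<nu> else 0) else 0) =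
        (\<Sum>i\<le>length w. if i = length \<sigma> then (if \<sigma> = ?s i \<and> \<nu> = ?t i then ?x \<sigma> * ?y \<nu> else 0) else 0)"
      by (intro sum.cong) (auto simp: min_def)
    also have "\<dots> = (if length \<sigma> \<le> length w \<and> \<sigma> = ?s (length \<sigma>) \<and> \<nu> = ?t (length \<sigma>) then ?x \<sigma> * ?y \<nu> else 0)"
      by simp
    also have "(length \<sigma> \<le> length w \<and> \<sigma> = ?s (length \<sigma>) \<and> \<nu> = ?t (length \<sigma>)) \<longleftrightarrow>
        inv_std w \<in> shuffles \<sigma> (map (\<lambda>k. k + length \<sigma>) \<nu>)"
      using inv_std_in_shuffles_iff[OF perms(1), of w \<nu>] perms(2) by metis
    finally show "?x \<sigma> * ?y \<nu> * (if inv_std w \<in> shuffles \<sigma> (map (\<lambda>k. k + length \<sigma>) \<nu>) then 1 else 0) =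
        (\<Sum>i\<le>length w. if \<nu> = ?t i then (if \<sigma> = ?s i then ?x \<sigma> * ?y \<nu> else 0) else 0)"
      by simp
  qed
  also have "\<dots> = (\<Sum>i\<le>length w. \<Sum>\<sigma>\<in>Poly_Mapping.keys x. \<Sum>\<nu>\<in>Poly_Mapping.keys y.
      if \<nu> = ?t i then (if \<sigma> = ?s i then ?x \<sigma> * ?y \<nu> else 0) else 0)"
    by (simp only: sum.swap[of _ "{..length w}" "Poly_Mapping.keys _"])
  also have "\<dots> = (\<Sum>i\<le>length w. \<Sum>\<sigma>\<in>Poly_Mapping.keys x.
      if \<sigma> = ?s i then ?x \<sigma> * ?y (?t i) else 0)"
    by (intro sum.cong refl) (auto simp: in_keys_iff)
  also have "\<dots> = (\<Sum>i\<le>length w. ?x (?s i) * ?y (?t i))"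
    by (intro sum.cong refl) (auto simp: in_keys_iff)
  finally show ?thesis .
qed

section \<open>Stability under the product, and the algebra morphism\<close>

lemma Baxter_keys: "x \<in> Baxter \<Longrightarrow> Poly_Mapping.keys x \<subseteq> perms"
  by (simp add: Baxter_iff)

lemma Baxter_lookup_cong:
  "x \<in> Baxter \<Longrightarrow> \<sigma> \<in> perms \<Longrightarrow> \<tau> \<in> perms \<Longrightarrow> P_symbol \<sigma> = P_symbol \<tau> \<Longrightarrow>
     Poly_Mapping.lookup x \<sigma> = Poly_Mapping.lookup x \<tau>"
  unfolding Baxter_iff by blast

lemma fqsym_mult_in_Baxter:
  assumes "x \<in> Baxter" "y \<in> Baxter"
  shows "fqsym_mult x y \<in> Baxter"
  unfolding Baxter_iff
proof (intro conjI ballI impI)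
  show "Poly_Mapping.keys (fqsym_mult x y) \<subseteq> perms"
    using assms by (intro keys_fqsym_mult Baxter_keys)
  fix \<sigma> \<tau>
  assume "\<sigma> \<in> perms" "\<tau> \<in> perms" and eq: "P_symbol \<sigma> = P_symbol \<tau>"
  then obtain u v :: "nat list" where uv: "\<sigma> = inv_std u" "\<tau> = inv_std v"
    using ex_nat_word by metis
  have len: "length u = length v"
    using length_P_symbol_eq[OF eq] by (simp add: uv)
  show "Poly_Mapping.lookup (fqsym_mult x y) \<sigma> = Poly_Mapping.lookup (fqsym_mult x y) \<tau>"
    unfolding uv lookup_fqsym_mult[OF assms[THEN Baxter_keys]] len
  proof (intro sum.cong refl arg_cong2[of _ _ _ _ "(*)"])
    fix i
    assume "i \<in> {..length v}"
    then have i: "i \<le> length u"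
      by (simp add: len)
    show "Poly_Mapping.lookup x (inv_std (take i u)) = Poly_Mapping.lookup x (inv_std (take i v))"
      "Poly_Mapping.lookup y (inv_std (drop i u)) = Poly_Mapping.lookup y (inv_std (drop i v))"
      by (rule Baxter_lookup_cong inv_std_in_perms assms P_symbol_take_drop[OF eq[unfolded uv] i])+
  qed
qed

lemma fqsym_one_in_Baxter: "fqsym_one \<in> Baxter"
  unfolding Baxter_iff
proof (intro conjI ballI impI)
  show "Poly_Mapping.keys fqsym_one \<subseteq> perms"
    by (simp add: fqsym_one_def F_basis_def perms_def)
  fix \<sigma> \<tau>
  assume "P_symbol \<sigma> = P_symbol \<tau>"
  then have "\<sigma> = [] \<longleftrightarrow> \<tau> = []"
    using length_P_symbol_eq[of \<sigma> \<tau>] by auto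
  then show "Poly_Mapping.lookup fqsym_one \<sigma> = Poly_Mapping.lookup fqsym_one \<tau>"
    by (auto simp: fqsym_one_def lookup_F_basis)
qed

lemma baxter_realization_algebra_morphism:
  "algebra_morphism_on (Baxter :: (nat list \<Rightarrow>\<^sub>0 'k::field) set) fqsym_mult fqsym_one
     (baxter_realization :: _ \<Rightarrow> 'a::linorder list \<Rightarrow> 'k)"
  unfolding algebra_morphism_on_def
proof (intro conjI ballI allI)
  show subspace: "pm.subspace (Baxter :: (nat list \<Rightarrow>\<^sub>0 'k) set)"
    by (simp add: Baxter_def)
  show "fqsym_one \<in> (Baxter :: (nat list \<Rightarrow>\<^sub>0 'k) set)"
    by (rule fqsym_one_in_Baxter)
  show "baxter_realization fqsym_one = (series_one :: 'a list \<Rightarrow> 'k)"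
  proof
    fix u :: "'a list"
    have "[] = inv_std u \<longleftrightarrow> u = []"
      by (metis length_0_conv length_inv_std)
    then show "baxter_realization fqsym_one u = (series_one u :: 'k)"
      using baxter_realization_eq[OF fqsym_one_in_Baxter, of u, where ?'k = 'k]
      by (simp add: fqsym_one_def lookup_F_basis series_one_def)
  qed
  fix x :: "nat list \<Rightarrow>\<^sub>0 'k"
  assume x: "x \<in> Baxter"
  show "(baxter_realization x :: 'a list \<Rightarrow> 'k) \<in> bounded_series"
    unfolding bounded_series_def
  proof (intro CollectI exI allI impI)
    fix u :: "'a list"
    \<comment> \<open>The degree bound is the greatest length in the support of \<open>x\<close>;
      inserting \<open>0\<close> covers empty support.\<close>
    assume *: "Max (insert 0 (length ` Poly_Mapping.keys x)) < length u"
    have "length u \<le> Max (insert 0 (length ` Poly_Mapping.keys x))" if "inv_std u \<in> Poly_Mapping.keys x"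
      using imageI[OF that, of length] by (intro Max_ge) simp_all
    then have "inv_std u \<notin> Poly_Mapping.keys x"
      using * by auto
    then show "baxter_realization x u = 0"
      by (simp add: baxter_realization_eq[OF x] in_keys_iff)
  qed
  show "baxter_realization (pm_scale c x) = (\<lambda>u :: 'a list. c * baxter_realization x u)" for c
    using x pm.subspace_scale[OF subspace] by (simp add: baxter_realization_eq fun_eq_iff)
  fix y :: "nat list \<Rightarrow>\<^sub>0 'k"
  assume y: "y \<in> Baxter"
  show "fqsym_mult x y \<in> Baxter"
    using x y by (rule fqsym_mult_in_Baxter)
  show "baxter_realization (x + y) = (\<lambda>u :: 'a list. baxter_realization x u + baxter_realization y u)"
    using x y pm.subspace_add[OF subspace] by (simp add: baxter_realization_eq fun_eq_iff lookup_add)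
  show "baxter_realization (fqsym_mult x y) =
      (series_mult (baxter_realization x) (baxter_realization y) :: 'a list \<Rightarrow> 'k)"
    using x y by (simp add: baxter_realization_eq fun_eq_iff series_mult_def lookup_fqsym_mult
        Baxter_keys fqsym_mult_in_Baxter)
qed

text \<open>Every permutation is \<open>inv_std u\<close> for a word \<open>u\<close> over the
  alphabet, so the series determines all coefficients on \<open>perms\<close>; the others
  vanish.\<close>

lemma baxter_realization_inj:
  fixes a :: "nat \<Rightarrow> 'a::linorder"
  assumes "strict_mono a"
  shows "inj_on (baxter_realization :: (nat list \<Rightarrow>\<^sub>0 'k::field) \<Rightarrow> 'a list \<Rightarrow> 'k) Baxter"
proof (intro inj_onI poly_mapping_eqI)
  fix x y :: "nat list \<Rightarrow>\<^sub>0 'k" and \<sigma>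
  assume x: "x \<in> Baxter" and y: "y \<in> Baxter"
    and eq: "baxter_realization x = (baxter_realization y :: 'a list \<Rightarrow> 'k)"
  show "Poly_Mapping.lookup x \<sigma> = Poly_Mapping.lookup y \<sigma>"
  proof (cases "\<sigma> \<in> perms")
    case True
    then obtain u :: "'a list" where "inv_std u = \<sigma>"
      using ex_inv_std[OF assms] by blast
    then show ?thesis
      using fun_cong[OF eq, of u] by (simp add: baxter_realization_eq x y)
  next
    case False
    then show ?thesis
      using x[THEN Baxter_keys] y[THEN Baxter_keys] by (metis in_keys_iff subsetD)
  qed
qed


section \<open>Coproduct\<close>

text \<open>Ranks start at 1, to match the letters of permutations.\<close>

definition nth_least :: "nat set \<Rightarrow> nat \<Rightarrow> nat" where
  "nth_least K i = sorted_list_of_set K ! (i - 1)"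

lemma map_nth_least:
  assumes "finite K"
  shows "map (nth_least K) [1..<Suc (card K)] = sorted_list_of_set K"
  using assms by (intro nth_equalityI) (simp_all add: nth_least_def del: upt_Suc)

lemma strict_mono_on_nth_least:
  assumes "finite K"
  shows "strict_mono_on {1..card K} (nth_least K)"
proof (rule strict_mono_onI)
  fix i j
  assume "i \<in> {1..card K}" "j \<in> {1..card K}" "i < j"
  then have "i - 1 < j - 1" "j - 1 < length (sorted_list_of_set K)"
    using assms by auto
  then show "nth_least K i < nth_least K j"
    unfolding nth_least_def
    by (rule sorted_wrt_nth_less[OF sorted_list_of_set.strict_sorted_key_list_of_set[where ?A = K]])
qed

lemma nth_least_image:
  assumes "finite K"
  shows "nth_least K ` {1..card K} = K"
proof -
  have "nth_least K ` set [1..<Suc (card K)] = set (sorted_list_of_set K)"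
    unfolding map_nth_least[OF assms, symmetric] by simp
  then show ?thesis
    using assms by (simp add: atLeastLessThanSuc_atLeastAtMost del: upt_Suc)
qed

section \<open>Ranks and standardization\<close>

lemma nth_perm_eq_card:
  assumes "\<sigma> \<in> perms" "j < length \<sigma>"
  shows "\<sigma> ! j = card {i. i < length \<sigma> \<and> \<sigma> ! i \<le> \<sigma> ! j}"
proof -
  have le: "\<sigma> ! j \<le> length \<sigma>"
    using assms nth_mem[of j \<sigma>] by (simp add: permsD(2))
  have "(!) \<sigma> ` {i. i < length \<sigma> \<and> \<sigma> ! i \<le> \<sigma> ! j} = {k \<in> set \<sigma>. k \<le> \<sigma> ! j}"
    by (auto simp: in_set_conv_nth)
  also have "\<dots> = {1..\<sigma> ! j}"
    using le assms(1) by (auto simp: permsD(2))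
  finally have "card ((!) \<sigma> ` {i. i < length \<sigma> \<and> \<sigma> ! i \<le> \<sigma> ! j}) = \<sigma> ! j"
    by simp
  moreover have "inj_on ((!) \<sigma>) {i. i < length \<sigma> \<and> \<sigma> ! i \<le> \<sigma> ! j}"
    using assms(1) by (intro inj_on_nth) (auto simp: permsD(1))
  ultimately show ?thesis
    by (simp add: card_image)
qed

lemma perms_eqI:
  assumes "\<sigma> \<in> perms" "\<tau> \<in> perms" "length \<sigma> = length \<tau>"
    and inv: "\<And>i j. i < j \<Longrightarrow> j < length \<sigma> \<Longrightarrow> \<sigma> ! i > \<sigma> ! j \<longleftrightarrow> \<tau> ! i > \<tau> ! j"
  shows "\<sigma> = \<tau>"
proof (rule nth_equalityI)
  \<comment> \<open>Inversions decide all comparisons, since letters at different places differ;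
    each letter is then its own rank.\<close>
  have le: "\<sigma> ! i \<le> \<sigma> ! j \<longleftrightarrow> \<tau> ! i \<le> \<tau> ! j" if "i < length \<sigma>" "j < length \<sigma>" for i j
  proof (cases i j rule: linorder_cases)
    case less
    then show ?thesis
      using inv[OF less that(2)] by linarith
  next
    case greater
    have "\<sigma> ! i \<noteq> \<sigma> ! j" "\<tau> ! i \<noteq> \<tau> ! j"
      using that greater assms(1-3) by (simp_all add: permsD(1) nth_eq_iff_index_eq)
    then show ?thesis
      using inv[OF greater that(1)] by linarith
  qed simp
  fix j
  assume "j < length \<sigma>"
  then have "{i. i < length \<sigma> \<and> \<sigma> ! i \<le> \<sigma> ! j} = {i. i < length \<tau> \<and> \<tau> ! i \<le> \<tau> ! j}"
    using le assms(3) by auto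
  with \<open>j < length \<sigma>\<close> show "\<sigma> ! j = \<tau> ! j"
    using nth_perm_eq_card[OF assms(1), of j] nth_perm_eq_card[OF assms(2), of j] assms(3)
    by (simp only:)
qed (fact assms(3))

text \<open>An increasing relabelling keeps the inversions, and \<open>perms_eqI\<close> gives the
  uniqueness demanded by the definite description in \<open>std\<close>.\<close>

lemma std_map:
  assumes "\<sigma> \<in> perms" "strict_mono_on {1..length \<sigma>} f"
  shows "std (map f \<sigma>) = \<sigma>"
proof -
  have inv: "map f \<sigma> ! i > map f \<sigma> ! j \<longleftrightarrow> \<sigma> ! i > \<sigma> ! j" if "i < length \<sigma>" "j < length \<sigma>" for i j
    using that strict_mono_on_less[OF assms(2), of "\<sigma> ! j" "\<sigma> ! i"] permsD(2)[OF assms(1)]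
      nth_mem[OF that(1)] nth_mem[OF that(2)] by simp
  show ?thesis
    unfolding std_def
  proof (rule the_equality)
    show "\<sigma> \<in> perms \<and> length \<sigma> = length (map f \<sigma>) \<and>
        (\<forall>i j. i < j \<and> j < length (map f \<sigma>) \<longrightarrow> (\<sigma> ! i > \<sigma> ! j \<longleftrightarrow> map f \<sigma> ! i > map f \<sigma> ! j))"
      using assms(1) inv by auto
    fix \<tau>
    assume \<tau>: "\<tau> \<in> perms \<and> length \<tau> = length (map f \<sigma>) \<and>
        (\<forall>i j. i < j \<and> j < length (map f \<sigma>) \<longrightarrow> (\<tau> ! i > \<tau> ! j \<longleftrightarrow> map f \<sigma> ! i > map f \<sigma> ! j))"
    show "\<tau> = \<sigma>"
    proof (rule perms_eqI)
      fix i j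
      assume "i < j" "j < length \<tau>"
      then show "\<tau> ! i > \<tau> ! j \<longleftrightarrow> \<sigma> ! i > \<sigma> ! j"
        using \<tau> inv[of i j] by simp
    qed (use \<tau> assms(1) in simp_all)
  qed
qed

text \<open>Replacing each letter by its rank in \<open>set xs\<close> gives a permutation, and
  \<open>nth_least (set xs)\<close> undoes this increasingly, so \<open>std_map\<close> identifies
  it as \<open>std xs\<close>.\<close>

lemma
  fixes xs :: "nat list"
  assumes "distinct xs"
  shows std_in_perms: "std xs \<in> perms"
    and length_std: "length (std xs) = length xs"
    and map_nth_least_std: "map (nth_least (set xs)) (std xs) = xs"
proof -
  let ?f = "nth_least (set xs)"
  have card: "card (set xs) = length xs"
    using assms by (rule distinct_card)
  have mono: "strict_mono_on {1..length xs} ?f"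
    using strict_mono_on_nth_least[of "set xs"] by (simp add: card)
  then have inj: "inj_on ?f {1..length xs}"
    by (rule strict_mono_on_imp_inj_on)
  have image: "?f ` {1..length xs} = set xs"
    using nth_least_image[of "set xs"] by (simp add: card)
  define \<tau> where "\<tau> = map (inv_into {1..length xs} ?f) xs"
  have "set \<tau> = inv_into {1..length xs} ?f ` (?f ` {1..length xs})"
    by (simp only: \<tau>_def set_map image)
  also have "\<dots> = {1..length xs}"
    using inj by (intro inv_into_image_cancel) auto
  finally have \<tau>: "\<tau> \<in> perms" "length \<tau> = length xs"
    using assms by (auto simp: perms_def card_distinct \<tau>_def)
  have "map ?f \<tau> = xs"
    unfolding \<tau>_def map_map using image by (intro map_idI) (simp add: f_inv_into_f)
  moreover from this have "std xs = \<tau>"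
    using std_map[OF \<tau>(1), of ?f] mono \<tau>(2) by simp
  ultimately show "std xs \<in> perms" "length (std xs) = length xs" "map ?f (std xs) = xs"
    using \<tau> by simp_all
qed

text \<open>\<open>juxtapose K \<sigma> \<nu>\<close> is the permutation with first letters in \<open>K\<close> standardizing to \<open>\<sigma>\<close> and
  remaining letters standardizing to \<open>\<nu>\<close>; the coproduct sums over all such \<open>K\<close>.\<close>

definition juxtapose :: "nat set \<Rightarrow> nat list \<Rightarrow> nat list \<Rightarrow> nat list" where
  "juxtapose K \<sigma> \<nu> =
     map (nth_least K) \<sigma> @ map (nth_least ({1..length \<sigma> + length \<nu>} - K)) \<nu>"

abbreviation value_sets :: "nat list \<Rightarrow> nat list \<Rightarrow> nat set set" where
  "value_sets \<sigma> \<nu> \<equiv> {K. K \<subseteq> {1..length \<sigma> + length \<nu>} \<and> card K = length \<sigma>}"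

lemma juxtapose:
  assumes perms: "\<sigma> \<in> perms" "\<nu> \<in> perms" and K: "K \<in> value_sets \<sigma> \<nu>"
  shows "juxtapose K \<sigma> \<nu> \<in> perms"
    and "set (take (length \<sigma>) (juxtapose K \<sigma> \<nu>)) = K"
    and "std (take (length \<sigma>) (juxtapose K \<sigma> \<nu>)) = \<sigma>"
    and "std (drop (length \<sigma>) (juxtapose K \<sigma> \<nu>)) = \<nu>"
proof -
  let ?N = "{1..length \<sigma> + length \<nu>}"
  have fin: "finite K" "finite (?N - K)"
    using K finite_subset[of K ?N] by auto
  have card: "card K = length \<sigma>" "card (?N - K) = length \<nu>"
    using K fin by (simp_all add: card_Diff_subset)
  have mono: "strict_mono_on {1..length \<sigma>} (nth_least K)" "strict_mono_on {1..length \<nu>} (nth_least (?N - K))"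
    using fin[THEN strict_mono_on_nth_least] card by simp_all
  have set: "nth_least K ` set \<sigma> = K" "nth_least (?N - K) ` set \<nu> = ?N - K"
    using fin[THEN nth_least_image] card perms by (simp_all add: permsD(2))
  have split: "take (length \<sigma>) (juxtapose K \<sigma> \<nu>) = map (nth_least K) \<sigma>"
    "drop (length \<sigma>) (juxtapose K \<sigma> \<nu>) = map (nth_least (?N - K)) \<nu>"
    by (simp_all add: juxtapose_def)
  have "set (juxtapose K \<sigma> \<nu>) = ?N"
    unfolding juxtapose_def set_append set_map set using K by blast
  moreover have "length (juxtapose K \<sigma> \<nu>) = length \<sigma> + length \<nu>"
    by (simp add: juxtapose_def)
  ultimately show "juxtapose K \<sigma> \<nu> \<in> perms"
    unfolding perms_def by (simp add: card_distinct)
  show "set (take (length \<sigma>) (juxtapose K \<sigma> \<nu>)) = K"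
    by (simp add: split set)
  show "std (take (length \<sigma>) (juxtapose K \<sigma> \<nu>)) = \<sigma>" "std (drop (length \<sigma>) (juxtapose K \<sigma> \<nu>)) = \<nu>"
    unfolding split using perms mono by (simp_all add: std_map)
qed

text \<open>The set \<open>K\<close> is forced to be the set of the first
  \<open>length \<sigma>\<close> letters of \<pi>; with it the two standardizations restore both
  parts of \<pi>.\<close>

lemma eq_juxtapose_iff:
  assumes perms: "\<sigma> \<in> perms" "\<nu> \<in> perms" "\<pi> \<in> perms"
  shows "\<pi> \<in> (\<lambda>K. juxtapose K \<sigma> \<nu>) ` value_sets \<sigma> \<nu> \<longleftrightarrow>
    length \<sigma> \<le> length \<pi> \<and> std (take (length \<sigma>) \<pi>) = \<sigma> \<and> std (drop (length \<sigma>) \<pi>) = \<nu>"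
proof
  assume "\<pi> \<in> (\<lambda>K. juxtapose K \<sigma> \<nu>) ` value_sets \<sigma> \<nu>"
  then obtain K where "K \<in> value_sets \<sigma> \<nu>" "\<pi> = juxtapose K \<sigma> \<nu>"
    by blast
  then show "length \<sigma> \<le> length \<pi> \<and> std (take (length \<sigma>) \<pi>) = \<sigma> \<and> std (drop (length \<sigma>) \<pi>) = \<nu>"
    using juxtapose(3,4)[OF perms(1,2), of K] by (simp add: juxtapose_def)
next
  assume *: "length \<sigma> \<le> length \<pi> \<and> std (take (length \<sigma>) \<pi>) = \<sigma> \<and> std (drop (length \<sigma>) \<pi>) = \<nu>"
  have dist: "distinct (take (length \<sigma>) \<pi>)" "distinct (drop (length \<sigma>) \<pi>)"
    using perms(3) by (simp_all add: permsD(1))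
  have len: "length \<pi> = length \<sigma> + length \<nu>"
    using * length_std[OF dist(2)] by simp
  define K where "K = set (take (length \<sigma>) \<pi>)"
  have "set \<pi> = {1..length \<sigma> + length \<nu>}"
    using perms(3) len by (simp add: permsD(2))
  moreover have "set \<pi> = K \<union> set (drop (length \<sigma>) \<pi>)"
    unfolding K_def set_append[symmetric] append_take_drop_id by (rule refl)
  moreover have "K \<inter> set (drop (length \<sigma>) \<pi>) = {}"
    using perms(3) unfolding K_def by (simp add: permsD(1) set_take_disj_set_drop_if_distinct)
  ultimately have K: "K \<subseteq> {1..length \<sigma> + length \<nu>}" "{1..length \<sigma> + length \<nu>} - K = set (drop (length \<sigma>) \<pi>)"
    by auto
  have "card K = length \<sigma>"
    unfolding K_def using distinct_card[OF dist(1)] * by simp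
  moreover have "juxtapose K \<sigma> \<nu> = \<pi>"
  proof -
    have "map (nth_least K) \<sigma> = take (length \<sigma>) \<pi>"
      using map_nth_least_std[OF dist(1)] * by (simp add: K_def)
    moreover have "map (nth_least ({1..length \<sigma> + length \<nu>} - K)) \<nu> = drop (length \<sigma>) \<pi>"
      using map_nth_least_std[OF dist(2)] * by (simp only: K(2))
    ultimately show ?thesis
      by (simp add: juxtapose_def)
  qed
  ultimately show "\<pi> \<in> (\<lambda>K. juxtapose K \<sigma> \<nu>) ` value_sets \<sigma> \<nu>"
    using K(1) by blast
qed

lemma finite_value_sets: "finite (value_sets \<sigma> \<nu>)"
  by (rule finite_subset[of _ "Pow {1..length \<sigma> + length \<nu>}"]) auto

lemma inj_on_juxtapose:
  assumes "\<sigma> \<in> perms" "\<nu> \<in> perms"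
  shows "inj_on (\<lambda>K. juxtapose K \<sigma> \<nu>) (value_sets \<sigma> \<nu>)"
  by (rule inj_on_inverseI[of _ "\<lambda>\<pi>. set (take (length \<sigma>) \<pi>)"]) (rule juxtapose(2)[OF assms])

section \<open>Coefficients of the coproduct and stability of \<open>Baxter\<close>\<close>

lemma lookup_fqsym_coproduct_eq:
  "Poly_Mapping.lookup (fqsym_coproduct x) (\<sigma>, \<nu>) =
    (\<Sum>\<pi>\<in>Poly_Mapping.keys x. Poly_Mapping.lookup x \<pi> *
       (\<Sum>i\<le>length \<pi>. if std (take i \<pi>) = \<sigma> \<and> std (drop i \<pi>) = \<nu> then 1 else 0))"
  unfolding fqsym_coproduct_def lookup_sum lookup_pm_scale lookup_tensor lookup_F_basis
  by (intro sum.cong refl arg_cong2[of _ _ _ _ "(*)"]) auto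

lemma keys_fqsym_coproduct:
  assumes "Poly_Mapping.keys x \<subseteq> perms"
  shows "Poly_Mapping.keys (fqsym_coproduct x) \<subseteq> perms \<times> perms"
proof (rule subsetI)
  fix p
  assume p: "p \<in> Poly_Mapping.keys (fqsym_coproduct x)"
  obtain \<sigma> \<nu> where "p = (\<sigma>, \<nu>)"
    by fastforce
  then have "(\<Sum>\<pi>\<in>Poly_Mapping.keys x. Poly_Mapping.lookup x \<pi> *
       (\<Sum>i\<le>length \<pi>. if std (take i \<pi>) = \<sigma> \<and> std (drop i \<pi>) = \<nu> then 1 else 0)) \<noteq> 0"
    using p by (simp only: in_keys_iff lookup_fqsym_coproduct_eq not_False_eq_True)
  then obtain \<pi> where \<pi>: "\<pi> \<in> Poly_Mapping.keys x"
    "Poly_Mapping.lookup x \<pi> *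
       (\<Sum>i\<le>length \<pi>. if std (take i \<pi>) = \<sigma> \<and> std (drop i \<pi>) = \<nu> then 1 else 0) \<noteq> 0"
    by (rule sum.not_neutral_contains_not_neutral)
  from \<pi>(2) have "(\<Sum>i\<le>length \<pi>. if std (take i \<pi>) = \<sigma> \<and> std (drop i \<pi>) = \<nu> then 1 else 0 :: 'a) \<noteq> 0"
    by (metis mult_zero_right)
  then obtain i where "(if std (take i \<pi>) = \<sigma> \<and> std (drop i \<pi>) = \<nu> then 1 else 0 :: 'a) \<noteq> 0"
    by (rule sum.not_neutral_contains_not_neutral)
  then have "std (take i \<pi>) = \<sigma>" "std (drop i \<pi>) = \<nu>"
    by (simp_all split: if_splits)
  moreover have "distinct \<pi>"
    using \<pi>(1) assms by (auto simp: permsD(1))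
  ultimately show "p \<in> perms \<times> perms"
    using std_in_perms[of "take i \<pi>"] std_in_perms[of "drop i \<pi>"] by (simp add: \<open>p = _\<close>)
qed

lemma lookup_fqsym_coproduct:
  assumes keys: "Poly_Mapping.keys x \<subseteq> perms" and perms: "\<sigma> \<in> perms" "\<nu> \<in> perms"
  shows "Poly_Mapping.lookup (fqsym_coproduct x) (\<sigma>, \<nu>) =
    (\<Sum>K\<in>value_sets \<sigma> \<nu>. Poly_Mapping.lookup x (juxtapose K \<sigma> \<nu>))"
proof -
  let ?I = "(\<lambda>K. juxtapose K \<sigma> \<nu>) ` value_sets \<sigma> \<nu>"
  have inner: "(\<Sum>i\<le>length \<pi>. if std (take i \<pi>) = \<sigma> \<and> std (drop i \<pi>) = \<nu> then 1 else 0 :: 'a) =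
      (if \<pi> \<in> ?I then 1 else 0)" if \<pi>: "\<pi> \<in> perms" for \<pi>
  proof -
    \<comment> \<open>Standardization keeps the length, so only the cut at
      \<open>i = length \<sigma>\<close> contributes.\<close>
    have "(\<Sum>i\<le>length \<pi>. if std (take i \<pi>) = \<sigma> \<and> std (drop i \<pi>) = \<nu> then 1 else 0 :: 'a) =
        (\<Sum>i\<le>length \<pi>. if i = length \<sigma> then
          (if std (take (length \<sigma>) \<pi>) = \<sigma> \<and> std (drop (length \<sigma>) \<pi>) = \<nu> then 1 else 0) else 0)"
    proof (intro sum.cong refl)
      fix i
      assume "i \<in> {..length \<pi>}"
      then have "length (std (take i \<pi>)) = i"
        using length_std[of "take i \<pi>"] permsD(1)[OF \<pi>] by simp
      then show "(if std (take i \<pi>) = \<sigma> \<and> std (drop i \<pi>) = \<nu> then 1 else 0 :: 'a) =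
          (if i = length \<sigma> then
            (if std (take (length \<sigma>) \<pi>) = \<sigma> \<and> std (drop (length \<sigma>) \<pi>) = \<nu> then 1 else 0) else 0)"
        by auto
    qed
    also have "\<dots> = (if length \<sigma> \<le> length \<pi> \<and> std (take (length \<sigma>) \<pi>) = \<sigma> \<and>
        std (drop (length \<sigma>) \<pi>) = \<nu> then 1 else 0)"
      by simp
    finally show ?thesis
      unfolding eq_juxtapose_iff[OF perms \<pi>] .
  qed
  have fin: "finite ?I"
    using finite_value_sets by (rule finite_imageI)
  have "Poly_Mapping.lookup (fqsym_coproduct x) (\<sigma>, \<nu>) =
      (\<Sum>\<pi>\<in>Poly_Mapping.keys x. if \<pi> \<in> ?I then Poly_Mapping.lookup x \<pi> else 0)"
    unfolding lookup_fqsym_coproduct_eq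
  proof (intro sum.cong refl)
    fix \<pi>
    assume "\<pi> \<in> Poly_Mapping.keys x"
    then have "\<pi> \<in> perms"
      using keys by blast
    show "Poly_Mapping.lookup x \<pi> *
        (\<Sum>i\<le>length \<pi>. if std (take i \<pi>) = \<sigma> \<and> std (drop i \<pi>) = \<nu> then 1 else 0) =
        (if \<pi> \<in> ?I then Poly_Mapping.lookup x \<pi> else 0)"
      unfolding inner[OF \<open>\<pi> \<in> perms\<close>] by simp
  qed
  also have "\<dots> = (\<Sum>\<pi>\<in>Poly_Mapping.keys x \<inter> ?I. Poly_Mapping.lookup x \<pi>)"
    by (simp add: sum.inter_restrict)
  \<comment> \<open>Permutations outside the support of \<open>x\<close> contribute
    \<open>0\<close>.\<close>
  also have "\<dots> = (\<Sum>\<pi>\<in>?I. Poly_Mapping.lookup x \<pi>)"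
    using fin by (intro sum.mono_neutral_left) (auto simp: in_keys_iff)
  also have "\<dots> = (\<Sum>K\<in>value_sets \<sigma> \<nu>. Poly_Mapping.lookup x (juxtapose K \<sigma> \<nu>))"
    using inj_on_juxtapose[OF perms] by (simp add: sum.reindex)
  finally show ?thesis .
qed

text \<open>The relabellings by \<open>nth_least\<close> act on trees label by label, and
  \<open>bst_of_append_cong\<close> joins the two parts; for the right-to-left tree the reversed
  parts are joined in the opposite order.\<close>

lemma P_symbol_juxtapose:
  assumes perms: "\<sigma> \<in> perms" "\<sigma>' \<in> perms" "\<nu> \<in> perms" "\<nu>' \<in> perms"
    and eq: "P_symbol \<sigma> = P_symbol \<sigma>'" "P_symbol \<nu> = P_symbol \<nu>'" and K: "K \<in> value_sets \<sigma> \<nu>"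
  shows "P_symbol (juxtapose K \<sigma> \<nu>) = P_symbol (juxtapose K \<sigma>' \<nu>')"
proof -
  have len: "length \<sigma> = length \<sigma>'" "length \<nu> = length \<nu>'"
    by (rule eq[THEN length_P_symbol_eq])+
  let ?N = "{1..length \<sigma> + length \<nu>}"
  have fin: "finite K" "finite (?N - K)"
    using K finite_subset[of K ?N] by auto
  have card: "card K = length \<sigma>" "card (?N - K) = length \<nu>"
    using K fin by (simp_all add: card_Diff_subset)
  have map: "bst_of (map (nth_least L) \<tau>) = bst_of (map (nth_least L) \<tau>') \<and>
      bst_of (rev (map (nth_least L) \<tau>)) = bst_of (rev (map (nth_least L) \<tau>'))"
    if "\<tau> \<in> perms" "\<tau>' \<in> perms" "P_symbol \<tau> = P_symbol \<tau>'" "finite L" "card L = length \<tau>" for L \<tau> \<tau>'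
  proof -
    have "set \<tau> = {1..card L}" "set \<tau>' = {1..card L}"
      using that length_P_symbol_eq[OF that(3)] by (simp_all add: permsD(2))
    then have "bst_of (map (nth_least L) \<rho>) = map_tree (nth_least L) (bst_of \<rho>)"
      if "\<rho> \<in> {\<tau>, rev \<tau>, \<tau>', rev \<tau>'}" for \<rho>
      using that by (intro bst_of_map[OF strict_mono_on_nth_least[OF \<open>finite L\<close>]]) auto
    moreover have "bst_of \<tau> = bst_of \<tau>'" "bst_of (rev \<tau>) = bst_of (rev \<tau>')"
      using that(3) unfolding P_symbol_eq_iff[OF that(1,2)] by simp_all
    ultimately show ?thesis
      unfolding rev_map by simp
  qed
  have "bst_of (juxtapose K \<sigma> \<nu>) = bst_of (juxtapose K \<sigma>' \<nu>')"
    "bst_of (rev (juxtapose K \<sigma> \<nu>)) = bst_of (rev (juxtapose K \<sigma>' \<nu>'))"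
    unfolding juxtapose_def rev_append len[symmetric]
    by (intro bst_of_append_cong map[THEN conjunct1] map[THEN conjunct2] perms eq fin card)+
  then show ?thesis
    by (simp add: P_symbol_conv)
qed

lemma fqsym_coproduct_in_tensor_square:
  assumes x: "x \<in> Baxter"
  shows "fqsym_coproduct x \<in> tensor_square Baxter"
proof (rule tensor_square_BaxterI)
  show "Poly_Mapping.keys (fqsym_coproduct x) \<subseteq> perms \<times> perms"
    using keys_fqsym_coproduct Baxter_keys[OF x] .
  fix \<sigma> \<sigma>' \<nu> \<nu>'
  assume perms: "\<sigma> \<in> perms" "\<sigma>' \<in> perms" "\<nu> \<in> perms" "\<nu>' \<in> perms"
    and eq: "P_symbol \<sigma> = P_symbol \<sigma>'" "P_symbol \<nu> = P_symbol \<nu>'"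
  have "value_sets \<sigma> \<nu> = value_sets \<sigma>' \<nu>'"
    using eq[THEN length_P_symbol_eq] by simp
  moreover have "Poly_Mapping.lookup x (juxtapose K \<sigma> \<nu>) = Poly_Mapping.lookup x (juxtapose K \<sigma>' \<nu>')"
    if "K \<in> value_sets \<sigma> \<nu>" for K
    using that calculation perms eq
    by (intro Baxter_lookup_cong[OF x] juxtapose(1) P_symbol_juxtapose) blast+
  ultimately show "Poly_Mapping.lookup (fqsym_coproduct x) (\<sigma>, \<nu>) =
      Poly_Mapping.lookup (fqsym_coproduct x) (\<sigma>', \<nu>')"
    unfolding lookup_fqsym_coproduct[OF Baxter_keys[OF x] perms(1,3)]
      lookup_fqsym_coproduct[OF Baxter_keys[OF x] perms(2,4)]
    by (intro sum.cong) simp_all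
qed


section \<open>Alphabet doubling\<close>

lemma le_sum_simps [simp]:
  "Inl a \<le> Inl b \<longleftrightarrow> a \<le> b" "Inl a \<le> Inr d" "\<not> Inr c \<le> Inl b" "Inr c \<le> Inr d \<longleftrightarrow> c \<le> d"
  for a b :: "'a::linorder" and c d :: "'b::linorder"
  by (simp_all add: less_eq_sum_def)

text \<open>Left letters are smaller than right ones, so in a list sorted by key the left keys form
  a prefix.\<close>

lemma sorted_map_sum_split:
  fixes f :: "'c \<Rightarrow> 'a::linorder + 'b::linorder"
  assumes "sorted (map f zs)"
  shows "zs = filter (\<lambda>i. isl (f i)) zs @ filter (\<lambda>i. \<not> isl (f i)) zs"
  using assms
proof (induction zs)
  case (Cons z zs)
  show ?case
  proof (cases "f z")
    case (Inl a)
    then show ?thesis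
      using Cons by simp
  next
    case (Inr b)
    then have "\<not> isl (f i)" if "i \<in> set zs" for i
      using Cons.prems that by (cases "f i") auto
    then have "filter (\<lambda>i. isl (f i)) zs = []" "filter (\<lambda>i. \<not> isl (f i)) zs = zs"
      by (simp_all add: filter_empty_conv)
    then show ?thesis
      using Inr by simp
  qed
qed simp

text \<open>Positions start at 1, as the letters of \<open>inv_std u\<close> do.\<close>

definition positions :: "('a \<Rightarrow> bool) \<Rightarrow> 'a list \<Rightarrow> nat set" where
  "positions P u = {i \<in> {1..length u}. P (u ! (i - 1))}"

lemma finite_positions [simp]: "finite (positions P u)"
  by (simp add: positions_def)

lemma sorted_list_of_positions:
  "sorted_list_of_set (positions P u) = filter (\<lambda>i. P (u ! (i - 1))) [1..<Suc (length u)]"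
proof -
  let ?xs = "filter (\<lambda>i. P (u ! (i - 1))) [1..<Suc (length u)]"
  have "sorted_wrt (<) ?xs"
    by (intro sorted_wrt_filter) (simp del: upt_Suc)
  moreover have "set ?xs = positions P u"
    by (auto simp: positions_def simp del: upt_Suc)
  ultimately show ?thesis
    using sorted_list_of_set.idem_if_sorted_distinct[of ?xs] by (simp add: strict_sorted_iff)
qed

lemma map_nth_positions:
  "map (\<lambda>i. u ! (i - 1)) (sorted_list_of_set (positions P u)) = filter P u"
proof -
  have "map (\<lambda>i. u ! (i - 1)) [1..<Suc (length u)] = u"
    by (intro nth_equalityI) (simp_all del: upt_Suc)
  then have "filter P u = filter P (map (\<lambda>i. u ! (i - 1)) [1..<Suc (length u)])"
    by simp
  then show ?thesis
    by (simp add: filter_map comp_def sorted_list_of_positions del: upt_Suc)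
qed

lemma card_positions: "card (positions P u) = length (filter P u)"
  using arg_cong[OF map_nth_positions[of u P], of length] by simp

text \<open>The position of rank \<open>k\<close> in \<open>positions P u\<close> holds letter
  number \<open>k\<close> of \<open>filter P u\<close>, so sorting these positions is sorting those
  of the filtered word up to \<open>nth_least\<close>. The map \<open>g\<close> will be the
  projection from the ordered sum to one summand.\<close>

lemma sort_positions:
  fixes u :: "'a::linorder list" and g :: "'a \<Rightarrow> 'b::linorder"
  assumes g: "\<And>x y. P x \<Longrightarrow> P y \<Longrightarrow> x \<le> y \<longleftrightarrow> g x \<le> g y"
  shows "sort_key (\<lambda>i. u ! (i - 1)) (filter (\<lambda>i. P (u ! (i - 1))) [1..<Suc (length u)]) =
    map (nth_least (positions P u)) (inv_std (map g (filter P u)))"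
proof -
  let ?K = "positions P u"
  have nth: "filter P u ! (i - 1) = u ! (nth_least ?K i - 1)" "P (u ! (nth_least ?K i - 1))"
    if "i \<in> {1..card ?K}" for i
  proof -
    have *: "i - 1 < length (sorted_list_of_set ?K)" "i - 1 < length (filter P u)"
      using that by (simp_all flip: card_positions) arith+
    show "filter P u ! (i - 1) = u ! (nth_least ?K i - 1)"
      using nth_map[OF *(1), of "\<lambda>i. u ! (i - 1)"] by (simp only: map_nth_positions nth_least_def)
    then show "P (u ! (nth_least ?K i - 1))"
      using nth_mem[OF *(2)] by auto
  qed
  have "sort_key (\<lambda>i. u ! (i - 1)) (filter (\<lambda>i. P (u ! (i - 1))) [1..<Suc (length u)]) =
      map (nth_least ?K) (sort_key ((\<lambda>i. u ! (i - 1)) \<circ> nth_least ?K) [1..<Suc (card ?K)])"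
    unfolding sorted_list_of_positions[symmetric] map_nth_least[OF finite_positions, symmetric] sort_key_map
    by (rule refl)
  also have "sort_key ((\<lambda>i. u ! (i - 1)) \<circ> nth_least ?K) [1..<Suc (card ?K)] =
      sort_key (\<lambda>i. map g (filter P u) ! (i - 1)) [1..<Suc (card ?K)]"
  proof (rule sort_key_cong_le)
    fix i j
    assume "i \<in> set [1..<Suc (card ?K)]" "j \<in> set [1..<Suc (card ?K)]"
    then have ij: "i \<in> {1..card ?K}" "j \<in> {1..card ?K}"
      by (simp_all del: upt_Suc)
    then have "i - 1 < length (filter P u)" "j - 1 < length (filter P u)"
      by (simp_all flip: card_positions) arith+
    then show "((\<lambda>i. u ! (i - 1)) \<circ> nth_least ?K) i \<le> ((\<lambda>i. u ! (i - 1)) \<circ> nth_least ?K) j \<longleftrightarrow>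
        map g (filter P u) ! (i - 1) \<le> map g (filter P u) ! (j - 1)"
      using nth(1)[OF ij(1)] nth(1)[OF ij(2)] g[OF nth(2)[OF ij(1)] nth(2)[OF ij(2)]] by simp
  qed
  also have "\<dots> = inv_std (map g (filter P u))"
    by (simp add: inv_std_def card_positions del: upt_Suc)
  finally show ?thesis .
qed

lemma positions_Not: "positions (\<lambda>x. \<not> P x) u = {1..length u} - positions P u"
  by (auto simp: positions_def)

lemma length_restrict: "length (restrict_left u) + length (restrict_right u) = length u"
  by (simp add: restrict_left_def restrict_right_def sum_length_filter_compl)

text \<open>Sorting puts the positions of the left letters first, and inside each group the order is
  that of the corresponding restriction.\<close>

lemma inv_std_sum:
  fixes u :: "('a::linorder + 'b::linorder) list"
  shows "inv_std u =
    juxtapose (positions isl u) (inv_std (restrict_left u)) (inv_std (restrict_right u))"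
proof -
  let ?f = "\<lambda>i. u ! (i - 1)"
  have "inv_std u = filter (\<lambda>i. isl (?f i)) (inv_std u) @ filter (\<lambda>i. \<not> isl (?f i)) (inv_std u)"
    unfolding inv_std_def by (rule sorted_map_sum_split) (rule sorted_sort_key)
  also have "filter (\<lambda>i. isl (?f i)) (inv_std u) =
      map (nth_least (positions isl u)) (inv_std (restrict_left u))"
    unfolding inv_std_def[of u] filter_sort restrict_left_def
    by (rule sort_positions) (auto simp: isl_def)
  also have "filter (\<lambda>i. \<not> isl (?f i)) (inv_std u) =
      map (nth_least (positions (\<lambda>x. \<not> isl x) u)) (inv_std (restrict_right u))"
    unfolding inv_std_def[of u] filter_sort restrict_right_def
    by (rule sort_positions[of "\<lambda>x. \<not> isl x"]) (metis le_sum_simps(4) sum.collapse(2))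
  finally show ?thesis
    by (simp add: juxtapose_def positions_Not length_restrict)
qed

section \<open>Words with given restrictions\<close>

lemma restrict_eq_iff_shuffle:
  "restrict_left u = v \<and> restrict_right u = w \<longleftrightarrow> u \<in> shuffles (map Inl v) (map Inr w)"
proof
  have "map Inl (restrict_left u) = filter isl u"
    unfolding restrict_left_def map_map by (rule map_idI) (auto simp: isl_def)
  moreover have "map Inr (restrict_right u) = filter (\<lambda>x. \<not> isl x) u"
    unfolding restrict_right_def map_map by (rule map_idI) auto
  ultimately show "u \<in> shuffles (map Inl v) (map Inr w)" if "restrict_left u = v \<and> restrict_right u = w"
    using that partition_in_shuffles[of u isl] by auto
next
  assume u: "u \<in> shuffles (map Inl v) (map Inr w)"
  have "filter isl u \<in> shuffles (filter isl (map Inl v)) (filter isl (map Inr w))"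
    "filter (\<lambda>x. \<not> isl x) u \<in>
      shuffles (filter (\<lambda>x. \<not> isl x) (map Inl v)) (filter (\<lambda>x. \<not> isl x) (map Inr w))"
    unfolding filter_shuffles[symmetric] using u by (rule imageI)+
  then show "restrict_left u = v \<and> restrict_right u = w"
    by (simp add: restrict_left_def restrict_right_def filter_map comp_def)
qed

text \<open>The pattern \<open>map isl u\<close> tells from which restriction each next letter is
  taken.\<close>

lemma sum_words_eqI:
  "map isl u = map isl u' \<Longrightarrow> restrict_left u = restrict_left u' \<Longrightarrow>
     restrict_right u = restrict_right u' \<Longrightarrow> u = u'"
proof (induction u arbitrary: u')
  case (Cons x u)
  then obtain y w where "u' = y # w"
    by (cases u') auto
  then show ?case
    using Cons by (cases x; cases y) (auto simp: restrict_left_def restrict_right_def)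
qed simp

text \<open>Both sets are counted by the same binomial coefficient, so injectivity suffices.\<close>

lemma bij_betw_positions:
  "bij_betw (positions isl) {u. restrict_left u = v \<and> restrict_right u = w}
     {K. K \<subseteq> {1..length v + length w} \<and> card K = length v}"
  (is "bij_betw _ ?U ?V")
proof -
  have inj: "inj_on (positions isl) ?U"
  proof (rule inj_onI)
    fix u u'
    assume u: "u \<in> ?U" "u' \<in> ?U" and eq: "positions isl u = positions isl u'"
    have len: "length u = length u'"
      using u length_restrict[of u] length_restrict[of u'] by auto
    have "isl (u ! i) \<longleftrightarrow> isl (u' ! i)" if "i < length u" for i
    proof -
      have "Suc i \<in> positions isl u \<longleftrightarrow> Suc i \<in> positions isl u'"
        by (simp only: eq)
      then show ?thesis
        using that len by (simp add: positions_def)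
    qed
    then have "map isl u = map isl u'"
      using len by (intro nth_equalityI) simp_all
    then show "u = u'"
      using u by (intro sum_words_eqI) auto
  qed
  have sub: "positions isl ` ?U \<subseteq> ?V"
  proof safe
    fix u
    show "card (positions isl u) = length (restrict_left u)"
      by (simp add: card_positions restrict_left_def)
    fix i
    assume "i \<in> positions isl u"
    then show "i \<in> {1..length (restrict_left u) + length (restrict_right u)}"
      by (simp add: positions_def length_restrict)
  qed
  have "card ?U = (length v + length w) choose length v"
    using card_disjoint_shuffles[of "map Inl v" "map Inr w"] by (auto simp: restrict_eq_iff_shuffle)
  also have "\<dots> = card ?V"
    by (simp add: n_subsets)
  finally have "card (positions isl ` ?U) = card ?V"
    by (simp add: card_image[OF inj])
  moreover have "finite ?V"
    by (rule finite_subset[of _ "Pow {1..length v + length w}"]) auto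
  ultimately have "positions isl ` ?U = ?V"
    using sub by (intro card_subset_eq)
  then show ?thesis
    using inj by (simp add: bij_betw_def)
qed

text \<open>The words restricting to \<open>v\<close> and \<open>w\<close> correspond to their sets
  of left positions, and these are the sets \<open>K\<close> indexing the coproduct
  coefficient.\<close>

lemma split_alphabets_baxter_realization:
  fixes x :: "nat list \<Rightarrow>\<^sub>0 'k::field"
  assumes x: "x \<in> Baxter"
  shows "split_alphabets (baxter_realization x) (v :: 'a::linorder list, w :: 'b::linorder list) =
    Poly_Mapping.lookup (fqsym_coproduct x) (inv_std v, inv_std w)"
proof -
  let ?U = "{u. restrict_left u = v \<and> restrict_right u = w}"
  have "split_alphabets (baxter_realization x) (v, w) =
      (\<Sum>u\<in>?U. Poly_Mapping.lookup x (juxtapose (positions isl u) (inv_std v) (inv_std w)))"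
    unfolding split_alphabets_def prod.case baxter_realization_eq[OF x]
    by (intro sum.cong refl) (auto simp: inv_std_sum)
  also have "\<dots> = (\<Sum>K | K \<subseteq> {1..length v + length w} \<and> card K = length v.
      Poly_Mapping.lookup x (juxtapose K (inv_std v) (inv_std w)))"
    by (rule sum.reindex_bij_betw[OF bij_betw_positions])
  also have "\<dots> = Poly_Mapping.lookup (fqsym_coproduct x) (inv_std v, inv_std w)"
    by (simp add: lookup_fqsym_coproduct[OF Baxter_keys[OF x] inv_std_in_perms inv_std_in_perms])
  finally show ?thesis .
qed

theorem theorem6p3:
  fixes a :: "nat \<Rightarrow> 'a::linorder"
  assumes "strict_mono a" and "range a = UNIV"
  shows "(\<forall>J\<in>twin_pairs. (baxter_realization (P_basis J) :: 'a list \<Rightarrow> 'k::field_char_0) =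
            (\<lambda>u. if (shape (incr u), shape (decr u)) = J then 1 else 0)) \<and>
         polynomial_realization
           (Baxter :: (nat list \<Rightarrow>\<^sub>0 'k) set) fqsym_mult fqsym_one fqsym_coproduct
           (baxter_realization :: (nat list \<Rightarrow>\<^sub>0 'k) \<Rightarrow> 'a list \<Rightarrow> 'k)
           (baxter_realization :: (nat list \<Rightarrow>\<^sub>0 'k) \<Rightarrow> ('a + 'a) list \<Rightarrow> 'k)"
proof (intro conjI ballI)
  show "baxter_realization (P_basis J) =
      (\<lambda>u :: 'a list. if (shape (incr u), shape (decr u)) = J then 1 else 0 :: 'k)" if "J \<in> twin_pairs" for J
    using that by (rule baxter_realization_P_basis)
  show "polynomial_realization
      (Baxter :: (nat list \<Rightarrow>\<^sub>0 'k) set) fqsym_mult fqsym_one fqsym_coproduct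
      (baxter_realization :: (nat list \<Rightarrow>\<^sub>0 'k) \<Rightarrow> 'a list \<Rightarrow> 'k)
      (baxter_realization :: (nat list \<Rightarrow>\<^sub>0 'k) \<Rightarrow> ('a + 'a) list \<Rightarrow> 'k)"
    unfolding polynomial_realization_def
  proof (intro conjI ballI)
    show "algebra_morphism_on (Baxter :: (nat list \<Rightarrow>\<^sub>0 'k) set) fqsym_mult fqsym_one
        (baxter_realization :: _ \<Rightarrow> 'a list \<Rightarrow> 'k)"
      by (rule baxter_realization_algebra_morphism)
    show "inj_on (baxter_realization :: (nat list \<Rightarrow>\<^sub>0 'k) \<Rightarrow> 'a list \<Rightarrow> 'k) Baxter"
      using assms(1) by (rule baxter_realization_inj)
    fix x :: "nat list \<Rightarrow>\<^sub>0 'k"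
    assume x: "x \<in> Baxter"
    show tensor: "fqsym_coproduct x \<in> tensor_square Baxter"
      using x by (rule fqsym_coproduct_in_tensor_square)
    have "pm.subspace (Baxter :: (nat list \<Rightarrow>\<^sub>0 'k) set)"
      by (simp add: Baxter_def)
    \<comment> \<open>Both realizations read coefficients at \<open>inv_std\<close>, so
      \<open>tensor_map_eq\<close> applies with \<open>p\<close> and \<open>q\<close> equal to
      \<open>inv_std\<close>.\<close>
    then have "tensor_map Baxter baxter_realization baxter_realization (fqsym_coproduct x) =
        (\<lambda>(v :: 'a list, w :: 'a list). Poly_Mapping.lookup (fqsym_coproduct x) (inv_std v, inv_std w))"
      using tensor baxter_realization_eq by (rule tensor_map_eq) (simp_all add: baxter_realization_eq)
    then show "split_alphabets (baxter_realization x :: ('a + 'a) list \<Rightarrow> 'k) =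
        tensor_map Baxter baxter_realization baxter_realization (fqsym_coproduct x)"
      by (auto simp: split_alphabets_baxter_realization[OF x])
  qed
qed

end
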